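(* Let $\varphi:A\to A'$ be a symplectic principal $\mathbb R$-bundle embedding between the symplectic principal $\mathbb R$-bundles $\mu:(A,\Omega)\to V$ and $\mu':(A',\Omega')\to V'$, and let $\varphi^V:V\to V'$ be the corresponding embedding between the base spaces. Then the Poisson structures $\Lambda_V$ and $\Lambda_{V'}$ induced on $V$ and $V'$, respectively, by $\mu$ and $\mu'$ are related by $$\Lambda_V(v)\big((\varphi^V)^*(\sigma'_1),(\varphi^V)^*(\sigma'_2)\big)=\Lambda_{V'}(\varphi^V(v))(\sigma'_1,\sigma'_2)-\Lambda_{V'}(\varphi^V(v))\big(\widetilde q_v(\sigma'_1),\widetilde q_v(\sigma'_2)\big)$$ for all $v\in V$ and $\sigma'_1,\sigma'_2\in T^*_{\varphi^V(v)}V'$. If $\varphi:A\to A'$ is an isomorphism of symplectic principal $\mathbb R$-bundles, then $\varphi^V:V\to V'$ is a Poisson isomorphism.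
   Context: A principal $\mathbb R$-bundle $\mu:A\to V$ is a principal bundle with structure group $(\mathbb R,+)$ and principal action $\psi$. A symplectic principal $\mathbb R$-bundle $\mu:(A,\Omega)\to V$ has moreover a symplectic form $\Omega$ on $A$ with $\psi_s^*\Omega=\Omega$ for all $s$. A symplectic principal $\mathbb R$-bundle embedding (resp. isomorphism) is an embedding (resp. diffeomorphism) $\varphi:A\to A'$ with $\varphi\circ\psi_s=\psi'_s\circ\varphi$ for all $s\in\mathbb R$ and $\varphi^*\Omega'=\Omega$. The induced map $\varphi^V:V\to V'$ is characterized by $\mu'\circ\varphi=\varphi^V\circ\mu$; it is an embedding (resp. a diffeomorphism). Poisson conventions: $i_{\mathcal H_F}\Omega=dF$, $\{F,F'\}_A=\Omega(\mathcal H_F,\mathcal H_{F'})$, and a Poisson bivector satisfies $\Lambda(df,df')=\{f,f'\}$. The Poisson structure $\Lambda_V$ on $V$ induced by $\mu$ is the unique one for which $\mu:A\to V$ is a Poisson map; likewise $\Lambda_{V'}$. Projector $\widetilde q_v$: identify $T_vV$ with $T_v\varphi^V(T_vV)\subset T_{\varphi^V(v)}V'$. For a subspace $W$ write $W^o$ for its annihilator in the dual space (here $(T_vV)^o\subset T^*_{\varphi^V(v)}V'$), and $\sharp_{\Lambda_{V'}}:T^*V'\to TV'$ for the bundle map $\alpha\mapsto\Lambda_{V'}(\cdot,\alpha)$. There is a splitting $T^*_{\varphi^V(v)}V'=(T_vV)^o\oplus\big(\sharp_{\Lambda_{V'}}(T_vV)^o\big)^o$, and $\widetilde q_v:T^*_{\varphi^V(v)}V'\to(T_vV)^o$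 is the first projector. *)

theory Defs
  imports "HOL-Analysis.Analysis"
begin

section \<open>Smooth manifolds\<close>

text \<open>
  A manifold is a type \<open>'m\<close> (Hausdorff and second countable, by sort) with an atlas of charts
  into a Euclidean space \<open>'e\<close>.  Euclidean spaces have dimension at least 1 here; this
  excludes only 0-dimensional manifolds.  A total space A of an \<open>\<real>\<close>-bundle is never
  0-dimensional, and if it is symplectic its base has dimension \<open>dim A - 1\<close>, an odd number.
\<close>

text \<open>Of class \<open>C\<^sup>k\<close> on an open set.\<close>

primrec Ck_on :: "nat \<Rightarrow> 'a set \<Rightarrow> ('a::euclidean_space \<Rightarrow> 'b::euclidean_space) \<Rightarrow> bool" where
  "Ck_on 0 S f \<longleftrightarrow> continuous_on S f"
| "Ck_on (Suc k) S f \<longleftrightarrow>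
     (\<forall>x\<in>S. f differentiable (at x)) \<and> (\<forall>u. Ck_on k S (\<lambda>x. frechet_derivative f (at x) u))"

definition smooth_on :: "'a set \<Rightarrow> ('a::euclidean_space \<Rightarrow> 'b::euclidean_space) \<Rightarrow> bool" where
  "smooth_on S f \<longleftrightarrow> (\<forall>k. Ck_on k S f)"

text \<open>A chart is a pair of its domain and its coordinate map (irrelevant off the domain).\<close>

type_synonym ('m, 'e) chart = "'m set \<times> ('m \<Rightarrow> 'e)"
type_synonym ('m, 'e) atlas = "('m, 'e) chart set"

definition chart_inv :: "('m, 'e) chart \<Rightarrow> 'e \<Rightarrow> 'm" where
  "chart_inv c = inv_into (fst c) (snd c)"

definition is_chart ::
  "('m::{t2_space,second_countable_topology}, 'e::euclidean_space) chart \<Rightarrow> bool" where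
  "is_chart c \<longleftrightarrow> open (fst c) \<and> open (snd c ` fst c)
     \<and> homeomorphism (fst c) (snd c ` fst c) (snd c) (chart_inv c)"

definition smooth_manifold ::
  "('m::{t2_space,second_countable_topology}, 'e::euclidean_space) atlas \<Rightarrow> bool" where
  "smooth_manifold M \<longleftrightarrow> (\<forall>c\<in>M. is_chart c) \<and> (\<Union>c\<in>M. fst c) = UNIV
     \<and> (\<forall>c\<in>M. \<forall>d\<in>M. smooth_on (snd c ` (fst c \<inter> fst d)) (snd d \<circ> chart_inv c))"

definition real_atlas :: "(real, real) atlas" where
  "real_atlas = {(UNIV, id)}"

definition prod_atlas :: "('m, 'e) atlas \<Rightarrow> ('n, 'f) atlas \<Rightarrow> ('m \<times> 'n, 'e \<times> 'f) atlas" where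
  "prod_atlas M N = {(fst c \<times> fst d, map_prod (snd c) (snd d)) | c d. c \<in> M \<and> d \<in> N}"

text \<open>Smooth maps and diffeomorphisms on open subsets.\<close>

definition smooth_map_on ::
  "('m::topological_space, 'e::euclidean_space) atlas \<Rightarrow> 'm set
    \<Rightarrow> ('n::topological_space, 'f::euclidean_space) atlas \<Rightarrow> ('m \<Rightarrow> 'n) \<Rightarrow> bool" where
  "smooth_map_on M S N f \<longleftrightarrow> continuous_on S f
     \<and> (\<forall>c\<in>M. \<forall>d\<in>N. smooth_on (snd c ` (fst c \<inter> S \<inter> f -` fst d)) (snd d \<circ> f \<circ> chart_inv c))"

abbreviation smooth_map where
  "smooth_map M N f \<equiv> smooth_map_on M UNIV N f"

abbreviation smooth_fun where
  "smooth_fun M f \<equiv> smooth_map M real_atlas f"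

definition diffeo_on ::
  "('m::topological_space, 'e::euclidean_space) atlas \<Rightarrow> 'm set
    \<Rightarrow> ('n::topological_space, 'f::euclidean_space) atlas \<Rightarrow> 'n set \<Rightarrow> ('m \<Rightarrow> 'n) \<Rightarrow> bool" where
  "diffeo_on M S N T f \<longleftrightarrow>
     bij_betw f S T \<and> smooth_map_on M S N f \<and> smooth_map_on N T M (inv_into S f)"

abbreviation diffeo where
  "diffeo M N f \<equiv> diffeo_on M UNIV N UNIV f"


section \<open>Tangent and cotangent spaces\<close>

text \<open>Pointwise linear combination, for tangent vectors as well as for covectors.\<close>

definition lincomb :: "real \<Rightarrow> ('i \<Rightarrow> 'b::real_vector) \<Rightarrow> real \<Rightarrow> ('i \<Rightarrow> 'b) \<Rightarrow> 'i \<Rightarrow> 'b" where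
  "lincomb r x s y = (\<lambda>i. r *\<^sub>R x i + s *\<^sub>R y i)"

definition linear_form_on :: "('i \<Rightarrow> 'b::real_vector) set \<Rightarrow> (('i \<Rightarrow> 'b) \<Rightarrow> real) \<Rightarrow> bool" where
  "linear_form_on S \<alpha> \<longleftrightarrow>
     (\<forall>x\<in>S. \<forall>y\<in>S. \<forall>r s. \<alpha> (lincomb r x s y) = r * \<alpha> x + s * \<alpha> y)"

definition skew_bilinear_form_on ::
  "('i \<Rightarrow> 'b::real_vector) set \<Rightarrow> (('i \<Rightarrow> 'b) \<Rightarrow> ('i \<Rightarrow> 'b) \<Rightarrow> real) \<Rightarrow> bool" where
  "skew_bilinear_form_on S B \<longleftrightarrow> (\<forall>y\<in>S. linear_form_on S (\<lambda>x. B x y))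
     \<and> (\<forall>x\<in>S. linear_form_on S (B x)) \<and> (\<forall>x\<in>S. \<forall>y\<in>S. B x y = - B y x)"

text \<open>
  A tangent vector at p is the family of its components in the charts around p, which
  transform by the derivatives of the coordinate changes; the value at all other charts is 0.
  A covector at p is a linear functional on the tangent space, extended by 0.
\<close>

type_synonym ('m, 'e) tvec = "('m, 'e) chart \<Rightarrow> 'e"
type_synonym ('m, 'e) covec = "('m, 'e) tvec \<Rightarrow> real"

definition charts_at :: "('m, 'e) atlas \<Rightarrow> 'm \<Rightarrow> ('m, 'e) chart set" where
  "charts_at M p = {c \<in> M. p \<in> fst c}"

definition tangent_space ::
  "('m, 'e::euclidean_space) atlas \<Rightarrow> 'm \<Rightarrow> ('m, 'e) tvec set" where
  "tangent_space M p = {X.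
     (\<forall>c\<in>charts_at M p. \<forall>d\<in>charts_at M p.
        X d = frechet_derivative (snd d \<circ> chart_inv c) (at (snd c p)) (X c))
     \<and> (\<forall>c. c \<notin> charts_at M p \<longrightarrow> X c = 0)}"

definition cotangent_space ::
  "('m, 'e::euclidean_space) atlas \<Rightarrow> 'm \<Rightarrow> ('m, 'e) covec set" where
  "cotangent_space M p = {\<alpha>. linear_form_on (tangent_space M p) \<alpha>
     \<and> (\<forall>X. X \<notin> tangent_space M p \<longrightarrow> \<alpha> X = 0)}"

text \<open>The tangent vector at p whose component in the chart c is u.\<close>

definition coord_vec ::
  "('m, 'e::euclidean_space) atlas \<Rightarrow> ('m, 'e) chart \<Rightarrow> 'm \<Rightarrow> 'e \<Rightarrow> ('m, 'e) tvec" where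
  "coord_vec M c p u = (\<lambda>d. if d \<in> charts_at M p
     then frechet_derivative (snd d \<circ> chart_inv c) (at (snd c p)) u else 0)"

text \<open>The choice of the source chart b is immaterial.\<close>

definition tangent_map ::
  "('m, 'e::euclidean_space) atlas \<Rightarrow> ('n, 'f::euclidean_space) atlas \<Rightarrow> ('m \<Rightarrow> 'n) \<Rightarrow> 'm
    \<Rightarrow> ('m, 'e) tvec \<Rightarrow> ('n, 'f) tvec" where
  "tangent_map M N f p X = (\<lambda>d. if d \<in> charts_at N (f p)
     then let b = (SOME b. b \<in> charts_at M p)
          in frechet_derivative (snd d \<circ> f \<circ> chart_inv b) (at (snd b p)) (X b)
     else 0)"

definition pullback_covec ::
  "('m, 'e::euclidean_space) atlas \<Rightarrow> ('n, 'f::euclidean_space) atlas \<Rightarrow> ('m \<Rightarrow> 'n) \<Rightarrow> 'm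
    \<Rightarrow> ('n, 'f) covec \<Rightarrow> ('m, 'e) covec" where
  "pullback_covec M N f p \<sigma> =
     (\<lambda>X. if X \<in> tangent_space M p then \<sigma> (tangent_map M N f p X) else 0)"

text \<open>The differential of a function; a tangent vector of \<open>\<real>\<close> is read in the chart \<open>id\<close>.\<close>

definition differential ::
  "('m, 'e::euclidean_space) atlas \<Rightarrow> ('m \<Rightarrow> real) \<Rightarrow> 'm \<Rightarrow> ('m, 'e) covec" where
  "differential M f p = pullback_covec M real_atlas f p (\<lambda>Y. Y (UNIV, id))"

definition smooth_embedding ::
  "('m::topological_space, 'e::euclidean_space) atlas
    \<Rightarrow> ('n::topological_space, 'f::euclidean_space) atlas \<Rightarrow> ('m \<Rightarrow> 'n) \<Rightarrow> bool" where
  "smooth_embedding M N f \<longleftrightarrow> smooth_map M N f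
     \<and> (\<forall>p. inj_on (tangent_map M N f p) (tangent_space M p))
     \<and> embedding_map euclidean euclidean f"


section \<open>Symplectic and Poisson structures\<close>

text \<open>A 2-form; only its values on tangent vectors at the given point are relevant.\<close>

type_synonym ('m, 'e) form2 = "'m \<Rightarrow> ('m, 'e) tvec \<Rightarrow> ('m, 'e) tvec \<Rightarrow> real"
type_synonym ('m, 'e) bivec = "'m \<Rightarrow> ('m, 'e) covec \<Rightarrow> ('m, 'e) covec \<Rightarrow> real"

definition form2_in_chart ::
  "('m, 'e::euclidean_space) atlas \<Rightarrow> ('m, 'e) form2 \<Rightarrow> ('m, 'e) chart
    \<Rightarrow> 'e \<Rightarrow> 'e \<Rightarrow> 'e \<Rightarrow> real" where
  "form2_in_chart M \<Omega> c u v x =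
     \<Omega> (chart_inv c x) (coord_vec M c (chart_inv c x) u) (coord_vec M c (chart_inv c x) v)"

text \<open>
  The last clause says \<open>d\<Omega> = 0\<close>: on constant vector fields of a chart, which commute,
  \<open>d\<Omega>(u,v,w) = u \<Omega>(v,w) + v \<Omega>(w,u) + w \<Omega>(u,v)\<close>.
\<close>

definition symplectic_form ::
  "('m::topological_space, 'e::euclidean_space) atlas \<Rightarrow> ('m, 'e) form2 \<Rightarrow> bool" where
  "symplectic_form M \<Omega> \<longleftrightarrow>
     (\<forall>p. skew_bilinear_form_on (tangent_space M p) (\<Omega> p))
   \<and> (\<forall>p. \<forall>X\<in>tangent_space M p. (\<forall>Y\<in>tangent_space M p. \<Omega> p X Y = 0) \<longrightarrow> X = (\<lambda>_. 0))
   \<and> (\<forall>c\<in>M. \<forall>u v. smooth_on (snd c ` fst c) (form2_in_chart M \<Omega> c u v))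
   \<and> (\<forall>c\<in>M. \<forall>x\<in>snd c ` fst c. \<forall>u v w.
        frechet_derivative (form2_in_chart M \<Omega> c v w) (at x) u
      + frechet_derivative (form2_in_chart M \<Omega> c w u) (at x) v
      + frechet_derivative (form2_in_chart M \<Omega> c u v) (at x) w = 0)"

text \<open>\<open>f\<^sup>*\<Omega>' = \<Omega>\<close>\<close>

definition pulls_back_form ::
  "('m, 'e::euclidean_space) atlas \<Rightarrow> ('m, 'e) form2
    \<Rightarrow> ('n, 'f::euclidean_space) atlas \<Rightarrow> ('n, 'f) form2 \<Rightarrow> ('m \<Rightarrow> 'n) \<Rightarrow> bool" where
  "pulls_back_form M \<Omega> N \<Omega>' f \<longleftrightarrow> (\<forall>p. \<forall>X\<in>tangent_space M p. \<forall>Y\<in>tangent_space M p.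
     \<Omega>' (f p) (tangent_map M N f p X) (tangent_map M N f p Y) = \<Omega> p X Y)"

text \<open>The Hamiltonian vector field of F at p, with the convention \<open>i\<^bsub>H\<^esub> \<Omega> = dF\<close>.\<close>

definition hamiltonian_vec ::
  "('m, 'e::euclidean_space) atlas \<Rightarrow> ('m, 'e) form2 \<Rightarrow> ('m \<Rightarrow> real) \<Rightarrow> 'm \<Rightarrow> ('m, 'e) tvec" where
  "hamiltonian_vec M \<Omega> F p = (THE X. X \<in> tangent_space M p
     \<and> (\<forall>Y\<in>tangent_space M p. \<Omega> p X Y = differential M F p Y))"

definition symplectic_bracket ::
  "('m, 'e::euclidean_space) atlas \<Rightarrow> ('m, 'e) form2
    \<Rightarrow> ('m \<Rightarrow> real) \<Rightarrow> ('m \<Rightarrow> real) \<Rightarrow> 'm \<Rightarrow> real" where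
  "symplectic_bracket M \<Omega> F G p = \<Omega> p (hamiltonian_vec M \<Omega> F p) (hamiltonian_vec M \<Omega> G p)"

definition bivec_bracket ::
  "('m, 'e::euclidean_space) atlas \<Rightarrow> ('m, 'e) bivec
    \<Rightarrow> ('m \<Rightarrow> real) \<Rightarrow> ('m \<Rightarrow> real) \<Rightarrow> 'm \<Rightarrow> real" where
  "bivec_bracket M \<Lambda> f g p = \<Lambda> p (differential M f p) (differential M g p)"

text \<open>A Poisson bivector; smoothness is tested on differentials of functions.\<close>

definition poisson_structure ::
  "('m::topological_space, 'e::euclidean_space) atlas \<Rightarrow> ('m, 'e) bivec \<Rightarrow> bool" where
  "poisson_structure M \<Lambda> \<longleftrightarrow>
     (\<forall>p. skew_bilinear_form_on (cotangent_space M p) (\<Lambda> p))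
   \<and> (\<forall>f g. smooth_fun M f \<longrightarrow> smooth_fun M g \<longrightarrow> smooth_fun M (bivec_bracket M \<Lambda> f g))
   \<and> (\<forall>f g h. smooth_fun M f \<longrightarrow> smooth_fun M g \<longrightarrow> smooth_fun M h \<longrightarrow>
        (\<forall>p. bivec_bracket M \<Lambda> f (bivec_bracket M \<Lambda> g h) p
           + bivec_bracket M \<Lambda> g (bivec_bracket M \<Lambda> h f) p
           + bivec_bracket M \<Lambda> h (bivec_bracket M \<Lambda> f g) p = 0))"

text \<open>Poisson maps, for given brackets of smooth functions on source and target.\<close>

definition poisson_map ::
  "('m::topological_space, 'e::euclidean_space) atlas
    \<Rightarrow> (('m \<Rightarrow> real) \<Rightarrow> ('m \<Rightarrow> real) \<Rightarrow> 'm \<Rightarrow> real)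
    \<Rightarrow> ('n::topological_space, 'f::euclidean_space) atlas
    \<Rightarrow> (('n \<Rightarrow> real) \<Rightarrow> ('n \<Rightarrow> real) \<Rightarrow> 'n \<Rightarrow> real) \<Rightarrow> ('m \<Rightarrow> 'n) \<Rightarrow> bool" where
  "poisson_map M brM N brN \<phi> \<longleftrightarrow> smooth_map M N \<phi>
     \<and> (\<forall>f g. smooth_fun N f \<longrightarrow> smooth_fun N g \<longrightarrow> brM (f \<circ> \<phi>) (g \<circ> \<phi>) = brN f g \<circ> \<phi>)"

definition poisson_isomorphism ::
  "('m::topological_space, 'e::euclidean_space) atlas \<Rightarrow> ('m, 'e) bivec
    \<Rightarrow> ('n::topological_space, 'f::euclidean_space) atlas \<Rightarrow> ('n, 'f) bivec
    \<Rightarrow> ('m \<Rightarrow> 'n) \<Rightarrow> bool" where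
  "poisson_isomorphism M \<Lambda> N \<Lambda>' \<phi> \<longleftrightarrow>
     diffeo M N \<phi> \<and> poisson_map M (bivec_bracket M \<Lambda>) N (bivec_bracket N \<Lambda>') \<phi>"


section \<open>Symplectic principal \<open>\<real>\<close>-bundles\<close>

text \<open>The last clause is equivariant local triviality.\<close>

definition principal_R_bundle ::
  "('a::{t2_space,second_countable_topology}, 'ea::euclidean_space) atlas \<Rightarrow> (real \<Rightarrow> 'a \<Rightarrow> 'a)
    \<Rightarrow> ('v::{t2_space,second_countable_topology}, 'ev::euclidean_space) atlas \<Rightarrow> ('a \<Rightarrow> 'v)
    \<Rightarrow> bool" where
  "principal_R_bundle A \<psi> V \<mu> \<longleftrightarrow> smooth_manifold A \<and> smooth_manifold V \<and> smooth_map A V \<mu>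
   \<and> smooth_map (prod_atlas real_atlas A) A (\<lambda>(s, a). \<psi> s a)
   \<and> \<psi> 0 = id \<and> (\<forall>s t. \<psi> (s + t) = \<psi> s \<circ> \<psi> t)
   \<and> (\<forall>v. \<exists>U \<Phi>. open U \<and> v \<in> U
        \<and> diffeo_on A (\<mu> -` U) (prod_atlas V real_atlas) (U \<times> UNIV) \<Phi>
        \<and> (\<forall>a\<in>\<mu> -` U. fst (\<Phi> a) = \<mu> a)
        \<and> (\<forall>a\<in>\<mu> -` U. \<forall>s. \<Phi> (\<psi> s a) = (fst (\<Phi> a), snd (\<Phi> a) + s)))"

definition symplectic_principal_R_bundle ::
  "('a::{t2_space,second_countable_topology}, 'ea::euclidean_space) atlas \<Rightarrow> ('a, 'ea) form2
    \<Rightarrow> (real \<Rightarrow> 'a \<Rightarrow> 'a)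
    \<Rightarrow> ('v::{t2_space,second_countable_topology}, 'ev::euclidean_space) atlas \<Rightarrow> ('a \<Rightarrow> 'v)
    \<Rightarrow> bool" where
  "symplectic_principal_R_bundle A \<Omega> \<psi> V \<mu> \<longleftrightarrow>
     principal_R_bundle A \<psi> V \<mu> \<and> symplectic_form A \<Omega> \<and> (\<forall>s. pulls_back_form A \<Omega> A \<Omega> (\<psi> s))"

definition symplectic_R_bundle_embedding ::
  "('a::topological_space, 'ea::euclidean_space) atlas \<Rightarrow> ('a, 'ea) form2 \<Rightarrow> (real \<Rightarrow> 'a \<Rightarrow> 'a)
    \<Rightarrow> ('b::topological_space, 'eb::euclidean_space) atlas \<Rightarrow> ('b, 'eb) form2
    \<Rightarrow> (real \<Rightarrow> 'b \<Rightarrow> 'b) \<Rightarrow> ('a \<Rightarrow> 'b) \<Rightarrow> bool" where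
  "symplectic_R_bundle_embedding A \<Omega> \<psi> A' \<Omega>' \<psi>' \<phi> \<longleftrightarrow>
     smooth_embedding A A' \<phi> \<and> (\<forall>s. \<phi> \<circ> \<psi> s = \<psi>' s \<circ> \<phi>) \<and> pulls_back_form A \<Omega> A' \<Omega>' \<phi>"

definition symplectic_R_bundle_isomorphism ::
  "('a::topological_space, 'ea::euclidean_space) atlas \<Rightarrow> ('a, 'ea) form2 \<Rightarrow> (real \<Rightarrow> 'a \<Rightarrow> 'a)
    \<Rightarrow> ('b::topological_space, 'eb::euclidean_space) atlas \<Rightarrow> ('b, 'eb) form2
    \<Rightarrow> (real \<Rightarrow> 'b \<Rightarrow> 'b) \<Rightarrow> ('a \<Rightarrow> 'b) \<Rightarrow> bool" where
  "symplectic_R_bundle_isomorphism A \<Omega> \<psi> A' \<Omega>' \<psi>' \<phi> \<longleftrightarrow>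
     diffeo A A' \<phi> \<and> (\<forall>s. \<phi> \<circ> \<psi> s = \<psi>' s \<circ> \<phi>) \<and> pulls_back_form A \<Omega> A' \<Omega>' \<phi>"

text \<open>
  \<open>\<Lambda>\<close> is the Poisson structure on V induced by \<open>\<mu>\<close>.  This determines \<open>\<Lambda> v\<close> on the
  cotangent space at v; off it, its values are irrelevant.
\<close>

definition induced_poisson_structure ::
  "('a::topological_space, 'ea::euclidean_space) atlas \<Rightarrow> ('a, 'ea) form2
    \<Rightarrow> ('v::topological_space, 'ev::euclidean_space) atlas \<Rightarrow> ('a \<Rightarrow> 'v) \<Rightarrow> ('v, 'ev) bivec
    \<Rightarrow> bool" where
  "induced_poisson_structure A \<Omega> V \<mu> \<Lambda> \<longleftrightarrow> poisson_structure V \<Lambda>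
     \<and> poisson_map A (symplectic_bracket A \<Omega>) V (bivec_bracket V \<Lambda>) \<mu>"


section \<open>The projector\<close>

text \<open>\<open>sharp M \<Lambda> p \<alpha> = \<Lambda>(\<cdot>, \<alpha>)\<close>, as a tangent vector at p.\<close>

definition sharp ::
  "('m, 'e::euclidean_space) atlas \<Rightarrow> ('m, 'e) bivec \<Rightarrow> 'm \<Rightarrow> ('m, 'e) covec \<Rightarrow> ('m, 'e) tvec" where
  "sharp M \<Lambda> p \<alpha> = (THE X. X \<in> tangent_space M p \<and> (\<forall>\<beta>\<in>cotangent_space M p. \<beta> X = \<Lambda> p \<beta> \<alpha>))"

definition annihilator ::
  "('m, 'e::euclidean_space) atlas \<Rightarrow> 'm \<Rightarrow> ('m, 'e) tvec set \<Rightarrow> ('m, 'e) covec set" where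
  "annihilator M p W = {\<alpha> \<in> cotangent_space M p. \<forall>X\<in>W. \<alpha> X = 0}"

text \<open>First projector of a splitting \<open>P \<oplus> Q\<close>.\<close>

definition first_projector :: "('i \<Rightarrow> real) set \<Rightarrow> ('i \<Rightarrow> real) set \<Rightarrow> ('i \<Rightarrow> real) \<Rightarrow> 'i \<Rightarrow> real" where
  "first_projector P Q \<sigma> = (THE \<tau>. \<tau> \<in> P \<and> (\<lambda>i. \<sigma> i - \<tau> i) \<in> Q)"

definition q_tilde ::
  "('m, 'e::euclidean_space) atlas \<Rightarrow> ('n, 'f::euclidean_space) atlas \<Rightarrow> ('n, 'f) bivec
    \<Rightarrow> ('m \<Rightarrow> 'n) \<Rightarrow> 'm \<Rightarrow> ('n, 'f) covec \<Rightarrow> ('n, 'f) covec" where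
  "q_tilde V V' \<Lambda>' f v =
     (let T = tangent_map V V' f v ` tangent_space V v;
          P = annihilator V' (f v) T
      in first_projector P (annihilator V' (f v) (sharp V' \<Lambda>' (f v) ` P)))"

end

theory Submission
  imports Defs
begin

text \<open>
  Fix \<open>a\<close> in \<open>A\<close>. A covector \<open>\<sigma>\<close> on the base at \<open>\<mu> a\<close>, pulled back by \<open>D\<mu>\<close>, is represented by
  the symplectic form: \<open>i\<^bsub>X\<^esub> \<Omega> = \<sigma> \<circ> D\<mu>\<close> for a unique \<open>X\<close> tangent to \<open>A\<close> at \<open>a\<close>. Since every
  covector is the differential of a smooth function (\<open>covector_is_differential\<close>, with a bump
  function), the requirement that \<open>\<mu>\<close> be a Poisson map amounts to \<open>\<Lambda>(\<sigma>\<^sub>1, \<sigma>\<^sub>2) = \<Omega>(X\<^sub>1, X\<^sub>2)\<close>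
  (\<open>induced_poisson_structure_eq\<close>). The comparison of \<open>\<Lambda>\<close> with \<open>\<Lambda>'\<close> thus becomes symplectic
  linear algebra at \<open>a\<close> and \<open>\<phi> a\<close>.

  As \<open>D\<phi>\<close> is symplectic, the tangent space of \<open>A'\<close> at \<open>\<phi> a\<close> is the direct sum of the image \<open>W\<close>
  of \<open>D\<phi>\<close> and its symplectic complement (\<open>symplectic_splitting\<close>). Let \<open>X'\<close> represent
  \<open>\<sigma>' \<circ> D\<mu>'\<close> and write \<open>X' = D\<phi> X + N\<close> accordingly. Then \<open>X\<close> represents the pullback of \<open>\<sigma>'\<close>
  to \<open>V\<close>, so the bracket of two pulled-back covectors is
  \<open>\<Omega>(X\<^sub>1, X\<^sub>2) = \<Omega>'(X'\<^sub>1, X'\<^sub>2) - \<Omega>'(N\<^sub>1, N\<^sub>2)\<close> (\<open>\<Lambda>_pullback\<close>). It remains to recognize \<open>N\<close> as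
  the vector that represents the projected covector (\<open>q_tilde_eq\<close>). The vertical spaces of both
  bundles are lines (\<open>vertical_line\<close>), and \<open>D\<phi>\<close> maps one onto the other, so \<open>W\<close> contains the vertical line of
  \<open>A'\<close>. Hence the functional represented by a vector orthogonal to \<open>W\<close> descends to \<open>V'\<close>, and
  the complement of \<open>W\<close> corresponds exactly to the annihilator \<open>P\<close> of the tangent space of \<open>V\<close>
  (\<open>orthogonal_represents_annihilator\<close>). On \<open>P\<close> the map \<open>sharp\<close> is \<open>D\<mu>'\<close> of the representing
  vector (\<open>sharp_eq\<close>), so the annihilator of \<open>sharp P\<close> corresponds to \<open>W\<close>, and the two
  splittings agree.

  If \<open>\<phi>\<close> is a diffeomorphism, then \<open>D\<phi>\<close> is onto and \<open>N = 0\<close>, so \<open>\<phi>V\<close> preserves brackets; it is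
  a diffeomorphism because fibres are orbits of the action and bundles have local sections.
\<close>

section \<open>Calculus of \<open>C\<^sup>k\<close> functions\<close>

lemma Ck_on_Suc_has_derivative:
  assumes "Ck_on (Suc k) S f" "x \<in> S"
  shows "(f has_derivative frechet_derivative f (at x)) (at x)"
  using assms by (simp add: frechet_derivative_works)

lemma Ck_on_cong_imp:
  assumes "open S" "\<And>x. x \<in> S \<Longrightarrow> f x = g x" "Ck_on k S f"
  shows "Ck_on k S g"
  using assms(2,3)
proof (induction k arbitrary: f g)
  case 0
  then show ?case by (simp cong: continuous_on_cong)
next
  case (Suc k)
  have D: "(g has_derivative frechet_derivative f (at x)) (at x)" if "x \<in> S" for x
    using Ck_on_Suc_has_derivative[OF Suc.prems(2) that] assms(1) that Suc.prems(1)
    by (rule has_derivative_transform_within_open)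
  have "Ck_on k S (\<lambda>x. frechet_derivative g (at x) u)" for u
  proof (rule Suc.IH)
    show "Ck_on k S (\<lambda>x. frechet_derivative f (at x) u)"
      using Suc.prems(2) by simp
    show "frechet_derivative f (at x) u = frechet_derivative g (at x) u" if "x \<in> S" for x
      using frechet_derivative_at[OF D[OF that]] by simp
  qed
  then show ?case using D by (auto simp: differentiable_def)
qed

lemma Ck_on_SucI:
  assumes "open S" "\<And>x. x \<in> S \<Longrightarrow> (f has_derivative D x) (at x)" "\<And>u. Ck_on k S (\<lambda>x. D x u)"
  shows "Ck_on (Suc k) S f"
proof -
  have "Ck_on k S (\<lambda>x. frechet_derivative f (at x) u)" for u
    by (rule Ck_on_cong_imp[OF assms(1) _ assms(3)[of u]])
      (use frechet_derivative_at[OF assms(2)] in auto)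
  then show ?thesis using assms(2) by (auto simp: differentiable_def)
qed

lemma Ck_on_Suc_imp: "Ck_on (Suc k) S f \<Longrightarrow> Ck_on k S f"
proof (induction k arbitrary: f)
  case 0
  then show ?case
    by (auto intro!: continuous_at_imp_continuous_on differentiable_imp_continuous_within)
next
  case (Suc k)
  show ?case
    using Suc.prems Suc.IH by (simp only: Ck_on.simps(2)[of "Suc k"]) simp
qed

lemma Ck_on_subset: "Ck_on k S f \<Longrightarrow> T \<subseteq> S \<Longrightarrow> Ck_on k T f"
  by (induction k arbitrary: f) (auto intro: continuous_on_subset)

lemma Ck_on_local:
  assumes "\<And>x. x \<in> S \<Longrightarrow> \<exists>U. open U \<and> x \<in> U \<and> Ck_on k U f"
  shows "Ck_on k S f"
  using assms
proof (induction k arbitrary: f)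
  case 0
  have "continuous (at x within S) f" if "x \<in> S" for x
    using 0[OF that] by (auto intro: continuous_at_imp_continuous_at_within
        simp: continuous_on_eq_continuous_at)
  then show ?case by (simp add: continuous_on_eq_continuous_within)
next
  case (Suc k)
  have "Ck_on k S (\<lambda>x. frechet_derivative f (at x) u)" for u
  proof (rule Suc.IH)
    fix x assume "x \<in> S"
    then show "\<exists>U. open U \<and> x \<in> U \<and> Ck_on k U (\<lambda>x. frechet_derivative f (at x) u)"
      using Suc.prems[of x] by auto
  qed
  moreover have "f differentiable (at x)" if "x \<in> S" for x
    using Suc.prems[OF that] by auto
  ultimately show ?case by simp
qed

lemma Ck_on_const: "Ck_on k S (\<lambda>x. c)"
proof (induction k arbitrary: c)
  case (Suc k)
  show ?case using Suc by simp
qed simp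

lemma Ck_on_bounded_linear:
  assumes "open S" "bounded_linear L" "Ck_on k S f"
  shows "Ck_on k S (\<lambda>x. L (f x))"
  using assms(3)
proof (induction k arbitrary: f)
  case 0
  then show ?case using assms(2) by (simp add: bounded_linear.continuous_on)
next
  case (Suc k)
  show ?case
  proof (rule Ck_on_SucI[OF assms(1)])
    show "((\<lambda>x. L (f x)) has_derivative (\<lambda>u. L (frechet_derivative f (at x) u))) (at x)"
      if "x \<in> S" for x
      using Ck_on_Suc_has_derivative[OF Suc.prems that] assms(2)
      by (rule bounded_linear.has_derivative[rotated])
    show "Ck_on k S (\<lambda>x. L (frechet_derivative f (at x) u))" for u
      using Suc.prems Suc.IH by simp
  qed
qed

lemma Ck_on_id: "open S \<Longrightarrow> Ck_on k S (\<lambda>x. x)"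
proof (cases k)
  case (Suc j)
  assume "open S"
  then show ?thesis unfolding Suc
    by (rule Ck_on_SucI[where D="\<lambda>x u. u"]) (auto intro: Ck_on_const)
qed simp

lemma Ck_on_linear:
  assumes "open S" "bounded_linear L"
  shows "Ck_on k S L"
  using Ck_on_bounded_linear[OF assms Ck_on_id[OF assms(1)]] by simp

lemma Ck_on_add:
  assumes "open S" "Ck_on k S f" "Ck_on k S g"
  shows "Ck_on k S (\<lambda>x. f x + g x)"
  using assms(2,3)
proof (induction k arbitrary: f g)
  case 0
  then show ?case by (simp add: continuous_on_add)
next
  case (Suc k)
  show ?case
  proof (rule Ck_on_SucI[OF assms(1)])
    show "((\<lambda>x. f x + g x) has_derivative
        (\<lambda>u. frechet_derivative f (at x) u + frechet_derivative g (at x) u)) (at x)"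
      if "x \<in> S" for x
      using Ck_on_Suc_has_derivative[OF Suc.prems(1) that]
        Ck_on_Suc_has_derivative[OF Suc.prems(2) that] by (rule has_derivative_add)
    show "Ck_on k S (\<lambda>x. frechet_derivative f (at x) u + frechet_derivative g (at x) u)" for u
      using Suc.prems Suc.IH by simp
  qed
qed

lemma Ck_on_sum:
  assumes "open S" "\<And>i. i \<in> I \<Longrightarrow> Ck_on k S (f i)"
  shows "Ck_on k S (\<lambda>x. \<Sum>i\<in>I. f i x)"
  using assms(2)
  by (induction I rule: infinite_finite_induct) (auto intro: Ck_on_const Ck_on_add[OF assms(1)])

lemma Ck_on_scaleR:
  fixes f :: "'a::euclidean_space \<Rightarrow> real" and g :: "'a \<Rightarrow> 'b::euclidean_space"
  assumes "open S" "Ck_on k S f" "Ck_on k S g"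
  shows "Ck_on k S (\<lambda>x. f x *\<^sub>R g x)"
  using assms(2,3)
proof (induction k arbitrary: f g)
  case 0
  then show ?case by (simp add: continuous_on_scaleR)
next
  case (Suc k)
  show ?case
  proof (rule Ck_on_SucI[OF assms(1)])
    show "((\<lambda>x. f x *\<^sub>R g x) has_derivative
        (\<lambda>u. f x *\<^sub>R frechet_derivative g (at x) u + frechet_derivative f (at x) u *\<^sub>R g x)) (at x)"
      if "x \<in> S" for x
      using Ck_on_Suc_has_derivative[OF Suc.prems(1) that]
        Ck_on_Suc_has_derivative[OF Suc.prems(2) that] by (rule has_derivative_scaleR)
    show "Ck_on k S (\<lambda>x. f x *\<^sub>R frechet_derivative g (at x) u
        + frechet_derivative f (at x) u *\<^sub>R g x)" for u
      using Suc.prems Suc.IH[of f] Suc.IH[of _ g] Ck_on_Suc_imp[OF Suc.prems(1)]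
        Ck_on_Suc_imp[OF Suc.prems(2)]
      by (intro Ck_on_add[OF assms(1)]) auto
  qed
qed

lemma Ck_on_compose:
  fixes f :: "'a::euclidean_space \<Rightarrow> 'b::euclidean_space" and g :: "'b \<Rightarrow> 'c::euclidean_space"
  assumes "open S" "Ck_on k S f" "Ck_on k T g" "f ` S \<subseteq> T"
  shows "Ck_on k S (g \<circ> f)"
  using assms(2,3)
proof (induction k arbitrary: g)
  case 0
  then show ?case using assms(4)
    by (auto intro!: continuous_on_compose intro: continuous_on_subset simp del: o_apply)
next
  case (Suc k)
  let ?D = "\<lambda>x u. \<Sum>b\<in>Basis. (frechet_derivative f (at x) u \<bullet> b) *\<^sub>R frechet_derivative g (at (f x)) b"
  show ?case
  proof (rule Ck_on_SucI[OF assms(1)])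
    fix x assume x: "x \<in> S"
    then have "f x \<in> T" using assms(4) by auto
    note g' = Ck_on_Suc_has_derivative[OF Suc.prems(2) this]
    have "(g \<circ> f has_derivative frechet_derivative g (at (f x)) \<circ> frechet_derivative f (at x)) (at x)"
      using Ck_on_Suc_has_derivative[OF Suc.prems(1) x] g' by (rule diff_chain_at)
    moreover have "frechet_derivative g (at (f x)) \<circ> frechet_derivative f (at x) = ?D x"
    proof
      fix u
      interpret g': linear "frechet_derivative g (at (f x))"
        using g' by (rule has_derivative_linear)
      have "frechet_derivative g (at (f x)) (frechet_derivative f (at x) u)
          = frechet_derivative g (at (f x)) (\<Sum>b\<in>Basis. (frechet_derivative f (at x) u \<bullet> b) *\<^sub>R b)"
        by (simp only: euclidean_representation)
      also have "\<dots> = ?D x u" by (simp only: g'.sum g'.scaleR)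
      finally show "(frechet_derivative g (at (f x)) \<circ> frechet_derivative f (at x)) u = ?D x u"
        by simp
    qed
    ultimately show "(g \<circ> f has_derivative ?D x) (at x)" by simp
  next
    fix u
    have 1: "Ck_on k S (\<lambda>x. frechet_derivative f (at x) u \<bullet> b)" for b
      using Suc.prems(1) by (intro Ck_on_bounded_linear[OF assms(1) bounded_linear_inner_left]) simp
    have 2: "Ck_on k S (\<lambda>x. frechet_derivative g (at (f x)) b)" for b
      using Suc.IH[OF Ck_on_Suc_imp[OF Suc.prems(1)], of "\<lambda>y. frechet_derivative g (at y) b"]
        Suc.prems(2) by (simp add: o_def)
    show "Ck_on k S (\<lambda>x. ?D x u)"
      by (intro Ck_on_sum[OF assms(1)] Ck_on_scaleR[OF assms(1)] 1 2)
  qed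
qed

lemma smooth_on_cong_imp:
  "open S \<Longrightarrow> (\<And>x. x \<in> S \<Longrightarrow> f x = g x) \<Longrightarrow> smooth_on S f \<Longrightarrow> smooth_on S g"
  using Ck_on_cong_imp[of S f g] by (simp add: smooth_on_def)

lemma smooth_on_subset: "smooth_on S f \<Longrightarrow> T \<subseteq> S \<Longrightarrow> smooth_on T f"
  using Ck_on_subset[of _ S f T] by (simp add: smooth_on_def)

lemma smooth_on_local:
  assumes "\<And>x. x \<in> S \<Longrightarrow> \<exists>U. open U \<and> x \<in> U \<and> smooth_on U f"
  shows "smooth_on S f"
  unfolding smooth_on_def
proof
  fix k
  show "Ck_on k S f"
    by (rule Ck_on_local) (use assms in \<open>auto simp: smooth_on_def\<close>)
qed

lemma smooth_on_const: "smooth_on S (\<lambda>x. c)"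
  by (simp add: smooth_on_def Ck_on_const)

lemma smooth_on_linear: "open S \<Longrightarrow> bounded_linear L \<Longrightarrow> smooth_on S L"
  by (simp add: smooth_on_def Ck_on_linear)

lemma smooth_on_add:
  "open S \<Longrightarrow> smooth_on S f \<Longrightarrow> smooth_on S g \<Longrightarrow> smooth_on S (\<lambda>x. f x + g x)"
  by (simp add: smooth_on_def Ck_on_add)

lemma smooth_on_scaleR:
  fixes f :: "'a::euclidean_space \<Rightarrow> real"
  shows "open S \<Longrightarrow> smooth_on S f \<Longrightarrow> smooth_on S g \<Longrightarrow> smooth_on S (\<lambda>x. f x *\<^sub>R g x)"
  by (simp add: smooth_on_def Ck_on_scaleR)

lemma smooth_on_compose:
  "open S \<Longrightarrow> smooth_on S f \<Longrightarrow> smooth_on T g \<Longrightarrow> f ` S \<subseteq> T \<Longrightarrow> smooth_on S (g \<circ> f)"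
  unfolding smooth_on_def by (intro allI Ck_on_compose[where T=T]) auto

lemma smooth_on_differentiable: "smooth_on S f \<Longrightarrow> x \<in> S \<Longrightarrow> f differentiable (at x)"
  unfolding smooth_on_def by (drule spec[of _ "Suc 0"]) simp

section \<open>A bump function\<close>

text \<open>
  For \<open>n = 0\<close> this is the classical smooth function that vanishes on the negative half-line and
  is positive on the positive one. The factor \<open>1 / t\<^sup>n\<close> makes the linear span of the family
  closed under differentiation.
\<close>

definition flat :: "nat \<Rightarrow> real \<Rightarrow> real" where
  "flat n t = (if t > 0 then exp (- (1 / t)) / t ^ n else 0)"

lemma flat_tendsto_0: "(flat n \<longlongrightarrow> 0) (at 0)"
proof -
  have "((\<lambda>s. s ^ n / exp s) \<longlongrightarrow> (0::real)) at_top"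
    using tendsto_power_div_exp_0 .
  then have "((\<lambda>t. inverse t ^ n / exp (inverse t)) \<longlongrightarrow> (0::real)) (at_right 0)"
    by (rule filterlim_compose[OF _ filterlim_inverse_at_top_right])
  moreover have "eventually (\<lambda>t. inverse t ^ n / exp (inverse t) = flat n t) (at_right (0::real))"
    by (rule eventually_at_rightI[of 0 1])
      (auto simp: flat_def exp_minus field_simps power_inverse)
  ultimately have "(flat n \<longlongrightarrow> 0) (at_right 0)"
    by (rule Lim_transform_eventually)
  moreover have "(flat n \<longlongrightarrow> 0) (at_left 0)"
    by (rule Lim_transform_eventually[OF tendsto_const])
      (auto intro!: eventually_at_leftI[of "-1"] simp: flat_def)
  ultimately show ?thesis by (simp add: filterlim_at_split)
qed

lemma flat_has_derivative:
  "(flat n has_real_derivative (flat (n + 2) t - real n * flat (n + 1) t)) (at t)"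
proof -
  consider "t > 0" | "t < 0" | "t = 0" by linarith
  then show ?thesis
  proof cases
    case 1
    have "((\<lambda>t. exp (- (1 / t)) / t ^ n) has_real_derivative
        (flat (n + 2) t - real n * flat (n + 1) t)) (at t)"
    proof (cases n)
      case 0
      then show ?thesis using 1
        by (auto intro!: derivative_eq_intros simp: flat_def field_simps power2_eq_square)
    next
      case (Suc m)
      have "((\<lambda>t. exp (- (1 / t))) has_real_derivative exp (- (1 / t)) / t\<^sup>2) (at t)"
        using 1 by (auto intro!: derivative_eq_intros simp: field_simps power2_eq_square)
      from DERIV_cong[OF DERIV_divide[OF this DERIV_pow[of "Suc m"]]] 1
      show ?thesis unfolding Suc by (simp add: flat_def field_simps power2_eq_square)
    qed
    then show ?thesis
      by (rule has_field_derivative_transform_within_open[of _ _ _ "{0<..}"])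
        (use 1 in \<open>auto simp: flat_def\<close>)
  next
    case 2
    have "((\<lambda>t. 0) has_real_derivative (flat (n + 2) t - real n * flat (n + 1) t)) (at t)"
      using 2 by (simp add: flat_def)
    then show ?thesis
      by (rule has_field_derivative_transform_within_open[of _ _ _ "{..<0}"])
        (use 2 in \<open>auto simp: flat_def\<close>)
  next
    case 3
    have "((\<lambda>h. (flat n (0 + h) - flat n 0) / h) \<longlongrightarrow> 0) (at 0)"
      by (rule Lim_transform_eventually[OF flat_tendsto_0[of "n + 1"]])
        (auto simp: flat_def eventually_at_filter field_simps)
    then show ?thesis using 3 by (simp add: DERIV_def flat_def)
  qed
qed

lemma Ck_on_flat: "Ck_on k UNIV (flat n)"
proof (induction k arbitrary: n)
  case 0
  then show ?case using flat_has_derivative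
    by (auto intro!: continuous_at_imp_continuous_on intro: DERIV_isCont)
next
  case (Suc k)
  show ?case
  proof (rule Ck_on_SucI)
    show "(flat n has_derivative (\<lambda>u. (flat (n + 2) x - real n * flat (n + 1) x) * u)) (at x)" for x
      using flat_has_derivative[of n x] by (simp add: has_field_derivative_def)
    have "Ck_on k UNIV (\<lambda>x. u *\<^sub>R flat (n + 2) x + (- real n * u) *\<^sub>R flat (n + 1) x)" for u
      by (intro Ck_on_add Ck_on_scaleR Ck_on_const Suc) auto
    then show "Ck_on k UNIV (\<lambda>x. (flat (n + 2) x - real n * flat (n + 1) x) * u)" for u
      by (simp add: algebra_simps)
  qed simp
qed

lemma smooth_bump_exists:
  fixes x0 :: "'a::euclidean_space"
  assumes "e > 0"
  obtains \<rho> :: "'a \<Rightarrow> real"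
  where "smooth_on UNIV \<rho>" "\<rho> x0 = 1" "\<And>x. x \<notin> ball x0 e \<Longrightarrow> \<rho> x = 0"
proof
  define q where "q x = e\<^sup>2 - (x - x0) \<bullet> (x - x0)" for x
  define \<rho> where "\<rho> x = (1 / flat 0 (e\<^sup>2)) *\<^sub>R (flat 0 \<circ> q) x" for x
  have "Ck_on (Suc k) UNIV q" for k
  proof (rule Ck_on_SucI)
    show "(q has_derivative (\<lambda>u. - (2 * ((x - x0) \<bullet> u)))) (at x)" for x
      unfolding q_def by (auto intro!: derivative_eq_intros simp: inner_commute)
    have "Ck_on k UNIV (\<lambda>x. (- 2) *\<^sub>R (x \<bullet> u) + 2 * (x0 \<bullet> u))" for u
      by (intro Ck_on_add Ck_on_scaleR Ck_on_const Ck_on_linear bounded_linear_inner_left) auto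
    then show "Ck_on k UNIV (\<lambda>x. - (2 * ((x - x0) \<bullet> u)))" for u
      by (simp add: algebra_simps)
  qed simp
  then have "smooth_on UNIV q" by (simp add: smooth_on_def Ck_on_Suc_imp)
  then have "smooth_on UNIV (flat 0 \<circ> q)"
    by (rule smooth_on_compose[OF open_UNIV, where T=UNIV]) (auto simp: smooth_on_def Ck_on_flat)
  then show "smooth_on UNIV \<rho>"
    unfolding \<rho>_def by (intro smooth_on_scaleR smooth_on_const open_UNIV)
  show "\<rho> x0 = 1" using assms by (simp add: \<rho>_def q_def flat_def)
  show "\<rho> x = 0" if "x \<notin> ball x0 e" for x
  proof -
    have "e\<^sup>2 \<le> (norm (x - x0))\<^sup>2"
      using that assms by (intro power_mono) (auto simp: dist_norm norm_minus_commute)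
    then show ?thesis by (simp add: \<rho>_def q_def flat_def power2_norm_eq_inner)
  qed
qed


section \<open>Charts and smooth maps of manifolds\<close>

lemma smooth_manifold_is_chart: "smooth_manifold M \<Longrightarrow> c \<in> M \<Longrightarrow> is_chart c"
  by (simp add: smooth_manifold_def)

lemma charts_atD: "c \<in> charts_at M p \<Longrightarrow> c \<in> M" "c \<in> charts_at M p \<Longrightarrow> p \<in> fst c"
  by (simp_all add: charts_at_def)

lemma charts_at_is_chart: "smooth_manifold M \<Longrightarrow> c \<in> charts_at M p \<Longrightarrow> is_chart c"
  by (simp add: charts_at_def smooth_manifold_is_chart)

lemma ex_charts_at:
  assumes "smooth_manifold M"
  obtains c where "c \<in> charts_at M p"
proof -
  have "p \<in> (\<Union>c\<in>M. fst c)" using assms by (simp add: smooth_manifold_def)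
  then show ?thesis using that by (auto simp: charts_at_def)
qed

lemma chart_inv_apply: "is_chart c \<Longrightarrow> q \<in> fst c \<Longrightarrow> chart_inv c (snd c q) = q"
  by (auto simp: is_chart_def homeomorphism_def)

lemma chart_apply_inv: "x \<in> snd c ` fst c \<Longrightarrow> snd c (chart_inv c x) = x"
  by (simp add: chart_inv_def f_inv_into_f)

lemma chart_inv_mem: "x \<in> snd c ` fst c \<Longrightarrow> chart_inv c x \<in> fst c"
  by (simp add: chart_inv_def inv_into_into)

lemma open_chart_dom: "is_chart c \<Longrightarrow> open (fst c)"
  by (simp add: is_chart_def)

lemma open_chart_image:
  assumes "is_chart c" "open U"
  shows "open (snd c ` (fst c \<inter> U))"
proof -
  have "homeomorphism (fst c) (snd c ` fst c) (snd c) (chart_inv c)" "open (snd c ` fst c)"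
    using assms by (auto simp: is_chart_def)
  then have "openin (top_of_set (snd c ` fst c)) (snd c ` (fst c \<inter> U))"
    using assms(2) by (intro homeomorphism_imp_open_map) (auto simp: openin_open)
  with \<open>open (snd c ` fst c)\<close> show ?thesis by (simp add: openin_open_eq)
qed

lemma smooth_map_on_cong_imp:
  assumes M: "smooth_manifold M" and N: "smooth_manifold N" and "open S"
    and eq: "\<And>p. p \<in> S \<Longrightarrow> f p = g p" and f: "smooth_map_on M S N f"
  shows "smooth_map_on M S N g"
  unfolding smooth_map_on_def
proof (intro conjI ballI)
  have contf: "continuous_on S f" using f by (simp add: smooth_map_on_def)
  then show "continuous_on S g" using eq by (simp cong: continuous_on_cong)
  fix c d assume c: "c \<in> M" and d: "d \<in> N"
  note cc = smooth_manifold_is_chart[OF M c]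
  have set_eq: "fst c \<inter> S \<inter> g -` fst d = fst c \<inter> S \<inter> f -` fst d" using eq by auto
  have op: "open (snd c ` (fst c \<inter> S \<inter> f -` fst d))"
    using open_chart_image[OF cc continuous_open_preimage[OF contf assms(3), of "fst d"]]
      open_chart_dom[OF smooth_manifold_is_chart[OF N d]] by (simp add: Int_assoc)
  show "smooth_on (snd c ` (fst c \<inter> S \<inter> g -` fst d)) (snd d \<circ> g \<circ> chart_inv c)"
    unfolding set_eq
  proof (rule smooth_on_cong_imp[OF op])
    show "smooth_on (snd c ` (fst c \<inter> S \<inter> f -` fst d)) (snd d \<circ> f \<circ> chart_inv c)"
      using f c d by (simp add: smooth_map_on_def)
    fix x assume "x \<in> snd c ` (fst c \<inter> S \<inter> f -` fst d)"
    then show "(snd d \<circ> f \<circ> chart_inv c) x = (snd d \<circ> g \<circ> chart_inv c) x"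
      using eq chart_inv_apply[OF cc] by auto
  qed
qed

lemma smooth_map_on_local:
  assumes M: "smooth_manifold M" and N: "smooth_manifold N"
    and loc: "\<And>p. p \<in> S \<Longrightarrow> \<exists>U. open U \<and> p \<in> U \<and> smooth_map_on M U N f"
  shows "smooth_map_on M S N f"
  unfolding smooth_map_on_def
proof (intro conjI ballI)
  have "continuous (at p within S) f" if "p \<in> S" for p
    using loc[OF that] by (auto intro: continuous_at_imp_continuous_at_within
        simp: continuous_on_eq_continuous_at smooth_map_on_def)
  then show "continuous_on S f" by (simp add: continuous_on_eq_continuous_within)
  fix c d assume c: "c \<in> M" and d: "d \<in> N"
  note cc = smooth_manifold_is_chart[OF M c]
  show "smooth_on (snd c ` (fst c \<inter> S \<inter> f -` fst d)) (snd d \<circ> f \<circ> chart_inv c)"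
  proof (rule smooth_on_local)
    fix x assume "x \<in> snd c ` (fst c \<inter> S \<inter> f -` fst d)"
    then obtain p where p: "p \<in> fst c" "p \<in> S" "f p \<in> fst d" "x = snd c p" by auto
    obtain U where U: "open U" "p \<in> U" "smooth_map_on M U N f" using loc[OF p(2)] by auto
    let ?U = "snd c ` (fst c \<inter> U \<inter> f -` fst d)"
    have "continuous_on U f" using U(3) by (simp add: smooth_map_on_def)
    from open_chart_image[OF cc continuous_open_preimage[OF this U(1), of "fst d"]]
    have "open ?U" using open_chart_dom[OF smooth_manifold_is_chart[OF N d]]
      by (simp add: Int_assoc)
    moreover have "x \<in> ?U" using p U(2) by auto
    moreover have "smooth_on ?U (snd d \<circ> f \<circ> chart_inv c)"
      using U(3) c d by (simp add: smooth_map_on_def)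
    ultimately show "\<exists>U. open U \<and> x \<in> U \<and> smooth_on U (snd d \<circ> f \<circ> chart_inv c)" by blast
  qed
qed

lemma smooth_map_on_compose:
  assumes M: "smooth_manifold M" and N: "smooth_manifold N" and P: "smooth_manifold P"
    and S: "open S" and f: "smooth_map_on M S N f" and g: "smooth_map_on N T P g"
    and fS: "f ` S \<subseteq> T"
  shows "smooth_map_on M S P (g \<circ> f)"
  unfolding smooth_map_on_def
proof (intro conjI ballI)
  have contf: "continuous_on S f" using f by (simp add: smooth_map_on_def)
  have "continuous_on T g" using g by (simp add: smooth_map_on_def)
  then show contgf: "continuous_on S (g \<circ> f)"
    using contf fS by (intro continuous_on_compose) (auto intro: continuous_on_subset)
  fix c e assume c: "c \<in> M" and e: "e \<in> P"
  note cc = smooth_manifold_is_chart[OF M c]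
  show "smooth_on (snd c ` (fst c \<inter> S \<inter> (g \<circ> f) -` fst e)) (snd e \<circ> (g \<circ> f) \<circ> chart_inv c)"
  proof (rule smooth_on_local)
    fix x assume "x \<in> snd c ` (fst c \<inter> S \<inter> (g \<circ> f) -` fst e)"
    then obtain p where p: "p \<in> fst c" "p \<in> S" "g (f p) \<in> fst e" "x = snd c p" by auto
    obtain n where n: "n \<in> charts_at N (f p)" using ex_charts_at[OF N] .
    note nn = charts_at_is_chart[OF N n]
    let ?W = "(S \<inter> (g \<circ> f) -` fst e) \<inter> (S \<inter> f -` fst n)"
    let ?U = "snd c ` (fst c \<inter> ?W)"
    have "open ?W"
      using open_chart_dom[OF smooth_manifold_is_chart[OF P e]] open_chart_dom[OF nn]
      by (intro open_Int continuous_open_preimage contf contgf S)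
    then have "open ?U" by (rule open_chart_image[OF cc])
    moreover have "x \<in> ?U" using p charts_atD[OF n] by auto
    moreover have "smooth_on ?U (snd e \<circ> (g \<circ> f) \<circ> chart_inv c)"
    proof (rule smooth_on_cong_imp[OF \<open>open ?U\<close>])
      show "smooth_on ?U ((snd e \<circ> g \<circ> chart_inv n) \<circ> (snd n \<circ> f \<circ> chart_inv c))"
      proof (rule smooth_on_compose[OF \<open>open ?U\<close>])
        have "smooth_on (snd c ` (fst c \<inter> S \<inter> f -` fst n)) (snd n \<circ> f \<circ> chart_inv c)"
          using f c charts_atD(1)[OF n] by (simp add: smooth_map_on_def)
        then show "smooth_on ?U (snd n \<circ> f \<circ> chart_inv c)"
          by (rule smooth_on_subset) auto
        show "smooth_on (snd n ` (fst n \<inter> T \<inter> g -` fst e)) (snd e \<circ> g \<circ> chart_inv n)"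
          using g e charts_atD(1)[OF n] by (simp add: smooth_map_on_def)
        show "(snd n \<circ> f \<circ> chart_inv c) ` ?U \<subseteq> snd n ` (fst n \<inter> T \<inter> g -` fst e)"
          using fS chart_inv_apply[OF cc] by auto
      qed
      fix y assume "y \<in> ?U"
      then show "(snd e \<circ> g \<circ> chart_inv n \<circ> (snd n \<circ> f \<circ> chart_inv c)) y
          = (snd e \<circ> (g \<circ> f) \<circ> chart_inv c) y"
        using chart_inv_apply[OF cc] chart_inv_apply[OF nn] by auto
    qed
    ultimately show "\<exists>U. open U \<and> x \<in> U \<and> smooth_on U (snd e \<circ> (g \<circ> f) \<circ> chart_inv c)"
      by blast
  qed
qed

lemma smooth_map_id: "smooth_manifold M \<Longrightarrow> smooth_map M M id"
  by (auto simp: smooth_map_on_def smooth_manifold_def simp flip: id_def)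

lemma smooth_manifold_real_atlas: "smooth_manifold real_atlas"
proof -
  have "chart_inv (UNIV, id) = (id :: real \<Rightarrow> real)"
    by (simp add: chart_inv_def fun_eq_iff inv_id[unfolded id_def] id_def)
  then show ?thesis
    by (auto simp: smooth_manifold_def real_atlas_def is_chart_def homeomorphism_def
        id_def o_def smooth_on_linear bounded_linear_ident)
qed

section \<open>Derivatives at a point\<close>

text \<open>
  Differentiability at a single point, read in all charts; this is what the pointwise chain
  rule needs.
\<close>

definition differentiable_map_at ::
  "('m::t2_space, 'e::euclidean_space) atlas
    \<Rightarrow> ('n::topological_space, 'f::euclidean_space) atlas \<Rightarrow> ('m \<Rightarrow> 'n) \<Rightarrow> 'm \<Rightarrow> bool" where
  "differentiable_map_at M N f p \<longleftrightarrow> isCont f p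
     \<and> (\<forall>c\<in>charts_at M p. \<forall>d\<in>charts_at N (f p).
          (snd d \<circ> f \<circ> chart_inv c) differentiable (at (snd c p)))"

text \<open>The derivative of \<open>f\<close> at \<open>p\<close> as a linear map between the model spaces of two charts.\<close>

definition chart_deriv ::
  "('m, 'e::euclidean_space) chart \<Rightarrow> ('n, 'f::euclidean_space) chart \<Rightarrow> ('m \<Rightarrow> 'n) \<Rightarrow> 'm
    \<Rightarrow> 'e \<Rightarrow> 'f" where
  "chart_deriv c d f p = frechet_derivative (snd d \<circ> f \<circ> chart_inv c) (at (snd c p))"

lemma smooth_map_on_differentiable_map_at:
  assumes "smooth_map_on M S N f" "open S" "p \<in> S"
  shows "differentiable_map_at M N f p"
  unfolding differentiable_map_at_def
proof (intro conjI ballI)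
  show "isCont f p"
    using assms by (simp add: smooth_map_on_def continuous_on_eq_continuous_at)
  fix c d assume cd: "c \<in> charts_at M p" "d \<in> charts_at N (f p)"
  then have "smooth_on (snd c ` (fst c \<inter> S \<inter> f -` fst d)) (snd d \<circ> f \<circ> chart_inv c)"
    using assms(1) by (simp add: smooth_map_on_def charts_atD)
  then show "(snd d \<circ> f \<circ> chart_inv c) differentiable (at (snd c p))"
    using cd assms(3) by (elim smooth_on_differentiable) (auto dest: charts_atD)
qed

lemma smooth_map_differentiable_map_at: "smooth_map M N f \<Longrightarrow> differentiable_map_at M N f p"
  by (rule smooth_map_on_differentiable_map_at[where S=UNIV]) auto

lemma differentiable_map_at_id: "smooth_manifold M \<Longrightarrow> differentiable_map_at M M id p"
  by (intro smooth_map_differentiable_map_at smooth_map_id)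

lemma chart_deriv_has_derivative:
  assumes "differentiable_map_at M N f p" "c \<in> charts_at M p" "d \<in> charts_at N (f p)"
  shows "((snd d \<circ> f \<circ> chart_inv c) has_derivative chart_deriv c d f p) (at (snd c p))"
  using assms by (simp add: differentiable_map_at_def chart_deriv_def frechet_derivative_works)

lemma linear_chart_deriv:
  assumes "differentiable_map_at M N f p" "c \<in> charts_at M p" "d \<in> charts_at N (f p)"
  shows "linear (chart_deriv c d f p)"
  using chart_deriv_has_derivative[OF assms] by (rule has_derivative_linear)

lemma chart_nbhd:
  assumes "is_chart c" "p \<in> fst c" "open U" "p \<in> U"
  obtains W where "open W" "snd c p \<in> W" "\<And>x. x \<in> W \<Longrightarrow> chart_inv c x \<in> U \<inter> fst c"
    "\<And>x. x \<in> W \<Longrightarrow> x \<in> snd c ` fst c"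
proof
  show "open (snd c ` (fst c \<inter> U))" using open_chart_image[OF assms(1,3)] .
qed (use assms chart_inv_apply[OF assms(1)] in auto)

lemma chart_deriv_cong:
  assumes "is_chart c" "p \<in> fst c" "open U" "p \<in> U" "\<And>q. q \<in> U \<Longrightarrow> f q = g q"
  shows "chart_deriv c d f p = chart_deriv c d g p"
proof -
  obtain W where W: "open W" "snd c p \<in> W" "\<And>x. x \<in> W \<Longrightarrow> chart_inv c x \<in> U \<inter> fst c"
    using chart_nbhd[OF assms(1-4)] by metis
  have "((snd d \<circ> f \<circ> chart_inv c) has_derivative D) (at (snd c p))
      \<longleftrightarrow> ((snd d \<circ> g \<circ> chart_inv c) has_derivative D) (at (snd c p))" for D
    using W assms(5) by (auto elim!: has_derivative_transform_within_open[OF _ W(1,2)])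
  then show ?thesis by (simp add: chart_deriv_def frechet_derivative_def)
qed

text \<open>
  The chain rule, for a chart of the intermediate space at the image point. The intermediate space
  need not be a manifold as a whole, so the rule also applies to product atlases.
\<close>

lemma compose_has_chart_deriv:
  assumes c: "is_chart c" "c \<in> charts_at M p" and n: "is_chart n" "n \<in> charts_at N (f p)"
    and e: "e \<in> charts_at P (g (f p))"
    and f: "differentiable_map_at M N f p" and g: "differentiable_map_at N P g (f p)"
  shows "((snd e \<circ> (g \<circ> f) \<circ> chart_inv c) has_derivative
    chart_deriv n e g (f p) \<circ> chart_deriv c n f p) (at (snd c p))"
proof -
  note p = charts_atD(2)[OF c(2)] and fp = charts_atD(2)[OF n(2)]
  have "isCont f p" using f by (simp add: differentiable_map_at_def)
  then obtain U where U: "open U" "p \<in> U" "\<forall>q\<in>U. f q \<in> fst n"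
    using fp open_chart_dom[OF n(1)] unfolding continuous_at_open by blast
  obtain W where W: "open W" "snd c p \<in> W" "\<And>x. x \<in> W \<Longrightarrow> chart_inv c x \<in> U \<inter> fst c"
    using chart_nbhd[OF c(1) p U(1,2)] by metis
  have "((snd e \<circ> g \<circ> chart_inv n) has_derivative chart_deriv n e g (f p))
      (at ((snd n \<circ> f \<circ> chart_inv c) (snd c p)))"
    using chart_deriv_has_derivative[OF g n(2) e] by (simp add: chart_inv_apply[OF c(1) p])
  from diff_chain_at[OF chart_deriv_has_derivative[OF f c(2) n(2)] this]
  show ?thesis
    by (rule has_derivative_transform_within_open[OF _ W(1,2)])
      (use W(3) U(3) chart_inv_apply[OF n(1)] in auto)
qed

lemma differentiable_map_at_compose:
  assumes "smooth_manifold M" "smooth_manifold N"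
    and f: "differentiable_map_at M N f p" and g: "differentiable_map_at N P g (f p)"
  shows "differentiable_map_at M P (g \<circ> f) p"
  unfolding differentiable_map_at_def
proof (intro conjI ballI)
  show "isCont (g \<circ> f) p"
    using f g by (auto simp: differentiable_map_at_def intro: continuous_at_compose)
  fix c e assume c: "c \<in> charts_at M p" and e: "e \<in> charts_at P ((g \<circ> f) p)"
  obtain n where n: "n \<in> charts_at N (f p)" using ex_charts_at[OF assms(2)] .
  show "(snd e \<circ> (g \<circ> f) \<circ> chart_inv c) differentiable (at (snd c p))"
    by (rule differentiableI[OF compose_has_chart_deriv[OF charts_at_is_chart[OF assms(1) c] c
          charts_at_is_chart[OF assms(2) n] n e[unfolded o_apply] f g]])
qed

lemma chart_deriv_compose:
  assumes "smooth_manifold M" "smooth_manifold N"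
    and "differentiable_map_at M N f p" "differentiable_map_at N P g (f p)"
    and "c \<in> charts_at M p" "n \<in> charts_at N (f p)" "e \<in> charts_at P (g (f p))"
  shows "chart_deriv c e (g \<circ> f) p = chart_deriv n e g (f p) \<circ> chart_deriv c n f p"
  using frechet_derivative_at[OF compose_has_chart_deriv[OF charts_at_is_chart[OF assms(1,5)]
    assms(5) charts_at_is_chart[OF assms(2,6)] assms(6,7,3,4)]]
  by (simp add: chart_deriv_def)

lemma chart_deriv_id_same:
  assumes "is_chart c" "p \<in> fst c"
  shows "chart_deriv c c id p = id"
proof -
  obtain W where W: "open W" "snd c p \<in> W" "\<And>x. x \<in> W \<Longrightarrow> x \<in> snd c ` fst c"
    using chart_nbhd[OF assms open_UNIV UNIV_I] by metis
  have "((snd c \<circ> id \<circ> chart_inv c) has_derivative id) (at (snd c p))"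
  proof (rule has_derivative_transform_within_open[OF _ W(1,2)])
    show "(id has_derivative id) (at (snd c p))" by (simp add: id_def)
    show "id x = (snd c \<circ> id \<circ> chart_inv c) x" if "x \<in> W" for x
      using chart_apply_inv[OF W(3)[OF that]] by simp
  qed
  from frechet_derivative_at[OF this] show ?thesis by (simp add: chart_deriv_def)
qed

section \<open>Tangent spaces and tangent maps\<close>

lemma tangent_space_chart:
  assumes "X \<in> tangent_space M p" "c \<in> charts_at M p" "d \<in> charts_at M p"
  shows "X d = chart_deriv c d id p (X c)"
proof -
  have "\<forall>c\<in>charts_at M p. \<forall>d\<in>charts_at M p.
      X d = frechet_derivative (snd d \<circ> chart_inv c) (at (snd c p)) (X c)"
    using assms(1) unfolding tangent_space_def mem_Collect_eq by (rule conjunct1)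
  from bspec[OF bspec[OF this assms(2)] assms(3)] show ?thesis
    by (simp only: chart_deriv_def comp_id)
qed

lemma tangent_space_outside: "X \<in> tangent_space M p \<Longrightarrow> c \<notin> charts_at M p \<Longrightarrow> X c = 0"
  unfolding tangent_space_def mem_Collect_eq by blast

lemma tangent_spaceI:
  assumes "\<And>c d. c \<in> charts_at M p \<Longrightarrow> d \<in> charts_at M p \<Longrightarrow> X d = chart_deriv c d id p (X c)"
    and "\<And>c. c \<notin> charts_at M p \<Longrightarrow> X c = 0"
  shows "X \<in> tangent_space M p"
  using assms unfolding tangent_space_def chart_deriv_def comp_id mem_Collect_eq by blast

lemma tangent_eqI:
  assumes "X \<in> tangent_space M p" "Y \<in> tangent_space M p" "c \<in> charts_at M p" "X c = Y c"
  shows "X = Y"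
proof
  fix d show "X d = Y d"
    using assms(4) tangent_space_chart[OF assms(1,3), of d] tangent_space_chart[OF assms(2,3), of d]
      tangent_space_outside[OF assms(1)] tangent_space_outside[OF assms(2)]
    by (cases "d \<in> charts_at M p") auto
qed

lemma lincomb_mem_tangent_space:
  assumes M: "smooth_manifold M" and "X \<in> tangent_space M p" "Y \<in> tangent_space M p"
  shows "lincomb r X s Y \<in> tangent_space M p"
proof (rule tangent_spaceI)
  fix c d assume cd: "c \<in> charts_at M p" "d \<in> charts_at M p"
  interpret linear "chart_deriv c d id p"
    using linear_chart_deriv[OF differentiable_map_at_id[OF M]] cd by simp
  show "lincomb r X s Y d = chart_deriv c d id p (lincomb r X s Y c)"
    by (simp add: lincomb_def add scaleR tangent_space_chart[OF assms(2) cd]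
        tangent_space_chart[OF assms(3) cd])
qed (simp add: lincomb_def tangent_space_outside[OF assms(2)] tangent_space_outside[OF assms(3)])

lemma zero_mem_tangent_space:
  assumes M: "smooth_manifold M"
  shows "(\<lambda>_. 0) \<in> tangent_space M p"
proof (rule tangent_spaceI)
  fix c d assume cd: "c \<in> charts_at M p" "d \<in> charts_at M p"
  show "0 = chart_deriv c d id p 0"
    using linear_0[OF linear_chart_deriv[OF differentiable_map_at_id[OF M]]] cd by simp
qed simp

lemma coord_vec_mem:
  assumes M: "smooth_manifold M" and c: "c \<in> charts_at M p"
  shows "coord_vec M c p u \<in> tangent_space M p"
proof (rule tangent_spaceI)
  fix b d assume b: "b \<in> charts_at M p" and d: "d \<in> charts_at M p"
  have "chart_deriv c d (id \<circ> id) p = chart_deriv b d id (id p) \<circ> chart_deriv c b id p"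
    using M b c d by (intro chart_deriv_compose) (auto intro: differentiable_map_at_id)
  then show "coord_vec M c p u d = chart_deriv b d id p (coord_vec M c p u b)"
    using b d by (simp add: coord_vec_def chart_deriv_def fun_eq_iff)
qed (simp add: coord_vec_def)

lemma coord_vec_same:
  assumes M: "smooth_manifold M" and c: "c \<in> charts_at M p"
  shows "coord_vec M c p u c = u"
  using chart_deriv_id_same[OF charts_at_is_chart[OF assms] charts_atD(2)[OF c]] c
  by (simp add: coord_vec_def chart_deriv_def fun_eq_iff)

lemma coord_vec_eq:
  assumes "smooth_manifold M" "c \<in> charts_at M p" "X \<in> tangent_space M p"
  shows "coord_vec M c p (X c) = X"
  using assms by (intro tangent_eqI[of _ M p _ c]) (auto simp: coord_vec_mem coord_vec_same)

lemma coord_vec_lincomb: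
  assumes "smooth_manifold M" "c \<in> charts_at M p"
  shows "coord_vec M c p (r *\<^sub>R u + s *\<^sub>R v) = lincomb r (coord_vec M c p u) s (coord_vec M c p v)"
  using assms
  by (intro tangent_eqI[of _ M p _ c])
    (auto simp: coord_vec_mem coord_vec_same lincomb_mem_tangent_space,
      simp add: lincomb_def coord_vec_same)

lemma linear_form_coord_vec:
  assumes "smooth_manifold M" "c \<in> charts_at M p" "linear_form_on (tangent_space M p) g"
  shows "linear (\<lambda>u. g (coord_vec M c p u))"
proof (rule linearI)
  have *: "g (coord_vec M c p (r *\<^sub>R u + s *\<^sub>R v))
      = r * g (coord_vec M c p u) + s * g (coord_vec M c p v)"
    for r s u v
    using assms(3) coord_vec_mem[OF assms(1,2)]
    by (simp add: coord_vec_lincomb[OF assms(1,2)] linear_form_on_def)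
  show "g (coord_vec M c p (u + v)) = g (coord_vec M c p u) + g (coord_vec M c p v)" for u v
    using *[of 1 u 1 v] by simp
  show "g (coord_vec M c p (r *\<^sub>R u)) = r *\<^sub>R g (coord_vec M c p u)" for r u
    using *[of r u 0 u] by simp
qed

text \<open>A differentiable map acts on components by its derivative in any pair of charts.\<close>

lemma tangent_map_chart:
  assumes M: "smooth_manifold M" and f: "differentiable_map_at M N f p"
    and X: "X \<in> tangent_space M p" and c: "c \<in> charts_at M p" and d: "d \<in> charts_at N (f p)"
  shows "tangent_map M N f p X d = chart_deriv c d f p (X c)"
proof -
  define b where "b = (SOME b. b \<in> charts_at M p)"
  have b: "b \<in> charts_at M p" unfolding b_def using c by (rule someI)
  have "chart_deriv b d (f \<circ> id) p = chart_deriv c d f (id p) \<circ> chart_deriv b c id p"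
    using M f b c d by (intro chart_deriv_compose) (auto intro: differentiable_map_at_id)
  then show ?thesis
    using d tangent_space_chart[OF X b c]
    by (simp add: tangent_map_def Let_def chart_deriv_def fun_eq_iff flip: b_def)
qed

lemma tangent_map_mem:
  assumes M: "smooth_manifold M" and N: "smooth_manifold N"
    and f: "differentiable_map_at M N f p" and X: "X \<in> tangent_space M p"
  shows "tangent_map M N f p X \<in> tangent_space N (f p)"
proof (rule tangent_spaceI)
  fix d e assume d: "d \<in> charts_at N (f p)" and e: "e \<in> charts_at N (f p)"
  obtain c where c: "c \<in> charts_at M p" using ex_charts_at[OF M] .
  have "chart_deriv c e (id \<circ> f) p = chart_deriv d e id (f p) \<circ> chart_deriv c d f p"
    using M N f c d e by (intro chart_deriv_compose) (auto intro: differentiable_map_at_id)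
  then show "tangent_map M N f p X e = chart_deriv d e id (f p) (tangent_map M N f p X d)"
    using tangent_map_chart[OF M f X c] d e by simp
qed (simp add: tangent_map_def)

lemma tangent_map_compose:
  assumes M: "smooth_manifold M" and N: "smooth_manifold N"
    and f: "differentiable_map_at M N f p" and g: "differentiable_map_at N P g (f p)"
    and X: "X \<in> tangent_space M p"
  shows "tangent_map M P (g \<circ> f) p X = tangent_map N P g (f p) (tangent_map M N f p X)"
proof
  fix e
  obtain c where c: "c \<in> charts_at M p" using ex_charts_at[OF M] .
  obtain n where n: "n \<in> charts_at N (f p)" using ex_charts_at[OF N] .
  show "tangent_map M P (g \<circ> f) p X e = tangent_map N P g (f p) (tangent_map M N f p X) e"
  proof (cases "e \<in> charts_at P (g (f p))")
    case True
    then show ?thesis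
      using tangent_map_chart[OF M differentiable_map_at_compose[OF M N f g] X c, of e]
        tangent_map_chart[OF N g tangent_map_mem[OF M N f X] n True]
        tangent_map_chart[OF M f X c n] chart_deriv_compose[OF M N f g c n True]
      by simp
  qed (simp add: tangent_map_def)
qed

lemma tangent_map_id:
  assumes M: "smooth_manifold M" and X: "X \<in> tangent_space M p"
  shows "tangent_map M M id p X = X"
proof -
  obtain c where c: "c \<in> charts_at M p" using ex_charts_at[OF M] .
  show ?thesis
    using tangent_map_mem[OF M M differentiable_map_at_id[OF M] X]
      tangent_map_chart[OF M differentiable_map_at_id[OF M] X c, of c]
      chart_deriv_id_same[OF charts_at_is_chart[OF M c] charts_atD(2)[OF c]] c X
    by (intro tangent_eqI[of _ M p _ c]) auto
qed

lemma tangent_map_lincomb: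
  assumes M: "smooth_manifold M" and f: "differentiable_map_at M N f p"
    and X: "X \<in> tangent_space M p" and Y: "Y \<in> tangent_space M p"
  shows "tangent_map M N f p (lincomb r X s Y)
    = lincomb r (tangent_map M N f p X) s (tangent_map M N f p Y)"
proof
  fix d
  obtain c where c: "c \<in> charts_at M p" using ex_charts_at[OF M] .
  show "tangent_map M N f p (lincomb r X s Y) d
    = lincomb r (tangent_map M N f p X) s (tangent_map M N f p Y) d"
  proof (cases "d \<in> charts_at N (f p)")
    case True
    interpret linear "chart_deriv c d f p" using linear_chart_deriv[OF f c True] .
    show ?thesis
      using tangent_map_chart[OF M f _ c True] X Y lincomb_mem_tangent_space[OF M X Y]
      by (simp add: lincomb_def add scaleR)
  qed (simp add: tangent_map_def lincomb_def)
qed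

section \<open>Covectors\<close>

lemma linear_form_pullback:
  assumes M: "smooth_manifold M" and N: "smooth_manifold N" and f: "differentiable_map_at M N f p"
    and g: "linear_form_on (tangent_space N (f p)) g"
  shows "linear_form_on (tangent_space M p) (\<lambda>X. g (tangent_map M N f p X))"
  using g tangent_map_mem[OF M N f] unfolding linear_form_on_def
  by (simp add: tangent_map_lincomb[OF M f])

lemma pullback_covec_mem:
  assumes M: "smooth_manifold M" and N: "smooth_manifold N" and f: "differentiable_map_at M N f p"
    and g: "\<sigma> \<in> cotangent_space N (f p)"
  shows "pullback_covec M N f p \<sigma> \<in> cotangent_space M p"
  using linear_form_pullback[OF M N f, of \<sigma>] g lincomb_mem_tangent_space[OF M]
  by (auto simp: cotangent_space_def pullback_covec_def linear_form_on_def)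

lemma real_chart_at: "(UNIV, id) \<in> charts_at real_atlas t"
  by (simp add: charts_at_def real_atlas_def)

lemma differential_mem:
  assumes M: "smooth_manifold M" and f: "differentiable_map_at M real_atlas f p"
  shows "differential M f p \<in> cotangent_space M p"
proof -
  let ?g = "\<lambda>Y :: (real, real) tvec. Y (UNIV, id)"
  have "linear_form_on (tangent_space real_atlas (f p)) ?g"
    by (simp add: linear_form_on_def lincomb_def)
  from linear_form_pullback[OF M smooth_manifold_real_atlas f this]
  show ?thesis using lincomb_mem_tangent_space[OF M]
    by (auto simp: cotangent_space_def differential_def pullback_covec_def linear_form_on_def)
qed

lemma differential_compose:
  assumes M: "smooth_manifold M" and N: "smooth_manifold N"
    and f: "differentiable_map_at M N f p" and g: "differentiable_map_at N real_atlas g (f p)"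
  shows "differential M (g \<circ> f) p = pullback_covec M N f p (differential N g (f p))"
  using tangent_map_compose[OF M N f g] tangent_map_mem[OF M N f]
  by (auto simp: differential_def pullback_covec_def fun_eq_iff)

text \<open>Covectors separate tangent vectors; the components in a chart already do.\<close>

lemma tangent_eq_covecI:
  assumes M: "smooth_manifold M" and X: "X \<in> tangent_space M p" and Y: "Y \<in> tangent_space M p"
    and eq: "\<And>\<beta>. \<beta> \<in> cotangent_space M p \<Longrightarrow> \<beta> X = \<beta> Y"
  shows "X = Y"
proof -
  obtain c where c: "c \<in> charts_at M p" using ex_charts_at[OF M] .
  have "X c \<bullet> b = Y c \<bullet> b" for b
  proof -
    let ?\<beta> = "\<lambda>X. if X \<in> tangent_space M p then X c \<bullet> b else 0"
    have "lincomb r X s Y c \<bullet> b = r * (X c \<bullet> b) + s * (Y c \<bullet> b)" for r s X Y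
      by (simp add: lincomb_def inner_add_left)
    then have "?\<beta> \<in> cotangent_space M p"
      by (simp add: cotangent_space_def linear_form_on_def lincomb_mem_tangent_space[OF M])
    from eq[OF this] show ?thesis by (simp only: X Y if_True)
  qed
  then have "X c = Y c" by (rule euclidean_eqI)
  with X Y c show ?thesis by (rule tangent_eqI)
qed

text \<open>
  A covector at \<open>p\<close> is the differential of a global function: in a chart around \<open>p\<close>, cut off the
  affine function with that differential by a bump function.
\<close>

lemma covector_is_differential:
  fixes M :: "('m::{t2_space,second_countable_topology}, 'e::euclidean_space) atlas"
  assumes M: "smooth_manifold M" and \<sigma>: "\<sigma> \<in> cotangent_space M p"
  obtains f where "smooth_fun M f" "differential M f p = \<sigma>"
proof -
  obtain c where c: "c \<in> charts_at M p" using ex_charts_at[OF M] .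
  note cc = charts_at_is_chart[OF M c] and pc = charts_atD(2)[OF c] and cM = charts_atD(1)[OF c]
  define x0 where "x0 = snd c p"
  define G where "G u = \<sigma> (coord_vec M c p u)" for u
  have linG: "linear G" unfolding G_def
    using linear_form_coord_vec[OF M c] \<sigma> by (simp add: cotangent_space_def)
  have blG: "bounded_linear G" using linG by (simp add: linear_conv_bounded_linear)
  have "open (snd c ` fst c)" "x0 \<in> snd c ` fst c" using cc pc by (auto simp: is_chart_def x0_def)
  then obtain e where e: "e > 0" "cball x0 e \<subseteq> snd c ` fst c"
    using open_contains_cball by metis
  obtain \<rho> :: "'e \<Rightarrow> real" where \<rho>: "smooth_on UNIV \<rho>" "\<rho> x0 = 1" "\<And>x. x \<notin> ball x0 e \<Longrightarrow> \<rho> x = 0"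
    using smooth_bump_exists[OF e(1)] by metis
  define F where "F x = \<rho> x *\<^sub>R (G x + - G x0)" for x
  have smF: "smooth_on UNIV F"
    unfolding F_def
    by (intro smooth_on_scaleR smooth_on_add smooth_on_const smooth_on_linear open_UNIV blG \<rho>)
  define f where "f q = (if q \<in> fst c then F (snd c q) else 0)" for q
  define K where "K = chart_inv c ` cball x0 e"
  have "continuous_on (cball x0 e) (chart_inv c)"
    using cc e(2) by (auto simp: is_chart_def homeomorphism_def intro: continuous_on_subset)
  then have "closed K" unfolding K_def
    by (intro compact_imp_closed compact_continuous_image) auto
  have Kc: "K \<subseteq> fst c" using e(2) chart_inv_mem[of _ c] by (auto simp: K_def)
  have f0: "f q = 0" if "q \<notin> K" for q
  proof (cases "q \<in> fst c")
    case True
    then have "snd c q \<notin> ball x0 e"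
      using that chart_inv_apply[OF cc True] unfolding K_def by (metis imageI ball_subset_cball subsetD)
    then show ?thesis using \<rho>(3) True by (simp add: f_def F_def)
  qed (simp add: f_def)
  have smf: "smooth_fun M f"
  proof (rule smooth_map_on_local[OF M smooth_manifold_real_atlas])
    fix q
    have zero: "smooth_map_on M (- K) real_atlas f"
      by (rule smooth_map_on_cong_imp[OF M smooth_manifold_real_atlas, of _ "\<lambda>_. 0"])
        (use \<open>closed K\<close> f0 in \<open>auto simp: smooth_map_on_def o_def real_atlas_def
          intro: smooth_on_const\<close>)
    have "smooth_map_on M (fst c) real_atlas f"
      unfolding smooth_map_on_def
    proof (intro conjI ballI)
      have "continuous_on UNIV F" using smF unfolding smooth_on_def by (metis Ck_on.simps(1))
      moreover have "continuous_on (fst c) (snd c)"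
        using cc by (simp add: is_chart_def homeomorphism_def)
      ultimately have "continuous_on (fst c) (\<lambda>q. F (snd c q))"
        by (rule continuous_on_compose2) auto
      then show "continuous_on (fst c) f" by (simp add: f_def cong: continuous_on_cong)
      fix b d assume b: "b \<in> M" and "d \<in> (real_atlas :: (real, real) atlas)"
      then have d: "d = (UNIV, id)" by (simp add: real_atlas_def)
      let ?U = "snd b ` (fst b \<inter> fst c)"
      have op: "open ?U"
        using open_chart_image[OF smooth_manifold_is_chart[OF M b] open_chart_dom[OF cc]] .
      have "smooth_on ?U (F \<circ> (snd c \<circ> chart_inv b))"
        using M b cM smF op
        by (intro smooth_on_compose[where T=UNIV]) (auto simp: smooth_manifold_def)
      then have "smooth_on ?U (f \<circ> chart_inv b)"
        by (rule smooth_on_cong_imp[OF op, rotated])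
          (use chart_inv_apply[OF smooth_manifold_is_chart[OF M b]] in \<open>auto simp: f_def\<close>)
      then show "smooth_on (snd b ` (fst b \<inter> fst c \<inter> f -` fst d)) (snd d \<circ> f \<circ> chart_inv b)"
        by (simp add: d)
    qed
    with zero show "\<exists>U. open U \<and> q \<in> U \<and> smooth_map_on M U real_atlas f"
      using Kc \<open>closed K\<close> open_chart_dom[OF cc] open_Compl[of K]
      by (metis ComplI subsetD)
  qed
  have "differential M f p X = \<sigma> X" for X
  proof (cases "X \<in> tangent_space M p")
    case True
    \<comment> \<open>The affine factor vanishes at \<open>x0\<close>, so the derivative of the bump function does not enter.\<close>
    have "((\<lambda>x. \<rho> x *\<^sub>R (G x + - G x0)) has_derivative
        (\<lambda>u. \<rho> x0 *\<^sub>R (G u + 0) + frechet_derivative \<rho> (at x0) u *\<^sub>R (G x0 + - G x0))) (at x0)"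
      using \<rho>(1) smooth_on_differentiable[OF \<rho>(1), of x0]
      by (intro has_derivative_scaleR has_derivative_add has_derivative_const
          bounded_linear_imp_has_derivative blG) (simp add: frechet_derivative_works)
    then have "(F has_derivative G) (at x0)"
      unfolding F_def[abs_def] by (simp add: \<rho>(2))
    then have "((snd (UNIV, id) \<circ> f \<circ> chart_inv c) has_derivative G) (at x0)"
      by (rule has_derivative_transform_within_open[OF _ \<open>open (snd c ` fst c)\<close> \<open>x0 \<in> snd c ` fst c\<close>])
        (use chart_inv_apply[OF cc] in \<open>auto simp: f_def\<close>)
    from frechet_derivative_at[OF this] have "chart_deriv c (UNIV, id) f p = G"
      by (simp add: chart_deriv_def x0_def)
    then show ?thesis
      using tangent_map_chart[OF M smooth_map_differentiable_map_at[OF smf] True c real_chart_at] True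
        coord_vec_eq[OF M c True]
      by (simp add: differential_def pullback_covec_def G_def)
  next
    case False
    then show ?thesis using \<sigma> by (simp add: differential_def pullback_covec_def cotangent_space_def)
  qed
  then have "differential M f p = \<sigma>" by auto
  with smf show ?thesis by (rule that)
qed


section \<open>Local structure of principal bundles\<close>

text \<open>The chart of the product with the real line that extends a chart of the first factor.\<close>

abbreviation line_chart :: "('v, 'ev) chart \<Rightarrow> ('v \<times> real, 'ev \<times> real) chart" where
  "line_chart d \<equiv> (fst d \<times> UNIV, map_prod (snd d) id)"

lemma line_chart_mem: "d \<in> M \<Longrightarrow> line_chart d \<in> prod_atlas M real_atlas"
  unfolding prod_atlas_def real_atlas_def
  by (rule CollectI, rule exI[of _ d], rule exI[of _ "(UNIV, id)"]) simp

lemma chart_inv_line_chart: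
  assumes "is_chart d" "x \<in> snd d ` fst d"
  shows "chart_inv (line_chart d) (x, t) = (chart_inv d x, t)"
proof -
  have "inj_on (snd d) (fst d)" using chart_inv_apply[OF assms(1)] by (rule inj_on_inverseI)
  then have "inj_on (map_prod (snd d) id) (fst d \<times> (UNIV :: real set))"
    by (auto simp: inj_on_def)
  then have "inv_into (fst d \<times> (UNIV :: real set)) (map_prod (snd d) id)
      (map_prod (snd d) id (chart_inv d x, t)) = (chart_inv d x, t)"
    using chart_inv_mem[OF assms(2)] by (intro inv_into_f_f) auto
  then show ?thesis using chart_apply_inv[OF assms(2)] by (simp add: chart_inv_def)
qed

lemma is_chart_line_chart:
  fixes d :: "('v::{t2_space,second_countable_topology}, 'ev::euclidean_space) chart"
  assumes "is_chart d"
  shows "is_chart (line_chart d)"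
proof -
  have im: "map_prod (snd d) (id :: real \<Rightarrow> real) ` (fst d \<times> UNIV) = (snd d ` fst d) \<times> UNIV"
    by (simp add: map_prod_surj_on)
  have hom: "open (fst d)" "open (snd d ` fst d)" "continuous_on (fst d) (snd d)"
      "continuous_on (snd d ` fst d) (chart_inv d)"
    using assms by (auto simp: is_chart_def homeomorphism_def)
  have "homeomorphism (fst d \<times> (UNIV :: real set)) (snd d ` fst d \<times> UNIV) (map_prod (snd d) id)
      (chart_inv (line_chart d))"
  proof (rule homeomorphismI)
    have "continuous_on (fst d \<times> (UNIV :: real set)) (\<lambda>z. (snd d (fst z), snd z))"
      by (intro continuous_intros continuous_on_compose2[OF hom(3)]) auto
    then show "continuous_on (fst d \<times> (UNIV :: real set)) (map_prod (snd d) id)"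
      by (simp add: map_prod_def case_prod_unfold)
    have "continuous_on (snd d ` fst d \<times> (UNIV :: real set)) (\<lambda>z. (chart_inv d (fst z), snd z))"
      by (intro continuous_intros continuous_on_compose2[OF hom(4)]) auto
    then show "continuous_on (snd d ` fst d \<times> (UNIV :: real set)) (chart_inv (line_chart d))"
      by (rule continuous_on_eq) (auto simp: chart_inv_line_chart[OF assms])
  qed (auto simp: chart_inv_line_chart[OF assms] chart_inv_apply[OF assms])
  then show ?thesis using hom(1,2) unfolding is_chart_def fst_conv snd_conv im
    by (simp add: open_Times)
qed

lemma bundle_smooth:
  assumes "principal_R_bundle A \<psi> V \<mu>"
  shows "smooth_manifold A" "smooth_manifold V" "smooth_map A V \<mu>"
  using assms by (simp_all add: principal_R_bundle_def)

lemma bundle_differentiable: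
  "principal_R_bundle A \<psi> V \<mu> \<Longrightarrow> differentiable_map_at A V \<mu> a"
  by (intro smooth_map_differentiable_map_at bundle_smooth(3))

lemma bundle_trivialization:
  assumes "principal_R_bundle A \<psi> V \<mu>"
  obtains U \<Phi> where "open U" "v \<in> U"
    "diffeo_on A (\<mu> -` U) (prod_atlas V real_atlas) (U \<times> UNIV) \<Phi>"
    "\<And>a. a \<in> \<mu> -` U \<Longrightarrow> fst (\<Phi> a) = \<mu> a"
    "\<And>a s. a \<in> \<mu> -` U \<Longrightarrow> \<Phi> (\<psi> s a) = (\<mu> a, snd (\<Phi> a) + s)"
proof -
  have "\<exists>U \<Phi>. open U \<and> v \<in> U
        \<and> diffeo_on A (\<mu> -` U) (prod_atlas V real_atlas) (U \<times> UNIV) \<Phi>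
        \<and> (\<forall>a\<in>\<mu> -` U. fst (\<Phi> a) = \<mu> a)
        \<and> (\<forall>a\<in>\<mu> -` U. \<forall>s. \<Phi> (\<psi> s a) = (fst (\<Phi> a), snd (\<Phi> a) + s))"
    using assms unfolding principal_R_bundle_def by blast
  then show ?thesis using that by (metis (no_types, lifting))
qed

text \<open>The value 0 of the fibre coordinate defines a section over each trivializing open set.\<close>

lemma bundle_section:
  fixes V :: "('v::{t2_space,second_countable_topology}, 'ev::euclidean_space) atlas"
  assumes "principal_R_bundle A \<psi> V \<mu>"
  obtains U s where "open U" "v \<in> U" "smooth_map_on V U A s" "\<And>w. w \<in> U \<Longrightarrow> \<mu> (s w) = w"
proof -
  obtain U \<Phi> where U: "open U" "v \<in> U"
    and \<Phi>: "diffeo_on A (\<mu> -` U) (prod_atlas V real_atlas) (U \<times> UNIV) \<Phi>"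
    and fst\<Phi>: "\<And>a. a \<in> \<mu> -` U \<Longrightarrow> fst (\<Phi> a) = \<mu> a"
    using bundle_trivialization[OF assms] by metis
  define \<Psi> where "\<Psi> = inv_into (\<mu> -` U) \<Phi>"
  define s where "s w = \<Psi> (w, 0)" for w
  have \<Psi>: "smooth_map_on (prod_atlas V real_atlas) (U \<times> UNIV) A \<Psi>"
    and bij: "bij_betw \<Phi> (\<mu> -` U) (U \<times> UNIV)"
    using \<Phi> by (auto simp: diffeo_on_def \<Psi>_def)
  have right_inv: "\<mu> (s w) = w" if "w \<in> U" for w
  proof -
    have "(w, 0) \<in> \<Phi> ` (\<mu> -` U)" using bij that by (simp add: bij_betw_def)
    from inv_into_into[OF this] f_inv_into_f[OF this]
    have "s w \<in> \<mu> -` U" "\<Phi> (s w) = (w, 0)" by (simp_all add: s_def \<Psi>_def)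
    then show ?thesis using fst\<Phi>[of "s w"] by simp
  qed
  have "continuous_on (U \<times> UNIV) \<Psi>" using \<Psi> by (simp add: smooth_map_on_def)
  then have conts: "continuous_on U s" unfolding s_def
    by (rule continuous_on_compose2) (auto intro!: continuous_intros)
  have "smooth_map_on V U A s"
    unfolding smooth_map_on_def
  proof (intro conjI ballI conts)
    fix c e assume c: "c \<in> V" and e: "e \<in> A"
    note cc = smooth_manifold_is_chart[OF bundle_smooth(2)[OF assms] c]
    note ee = smooth_manifold_is_chart[OF bundle_smooth(1)[OF assms] e]
    let ?W = "snd c ` (fst c \<inter> U \<inter> s -` fst e)"
    have op: "open ?W"
      using open_chart_image[OF cc continuous_open_preimage[OF conts U(1) open_chart_dom[OF ee]]]
      by (simp add: Int_assoc)
    have "smooth_on ?W ((snd e \<circ> \<Psi> \<circ> chart_inv (line_chart c)) \<circ> (\<lambda>x. (x, 0)))"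
    proof (rule smooth_on_compose[OF op])
      show "smooth_on ?W (\<lambda>x. (x, 0 :: real))"
        by (intro smooth_on_linear op bounded_linear_Pair bounded_linear_ident bounded_linear_zero)
      show "smooth_on (snd (line_chart c) ` (fst (line_chart c) \<inter> (U \<times> UNIV) \<inter> \<Psi> -` fst e))
          (snd e \<circ> \<Psi> \<circ> chart_inv (line_chart c))"
        using \<Psi> e line_chart_mem[OF c] unfolding smooth_map_on_def by blast
      show "(\<lambda>x. (x, 0)) ` ?W
          \<subseteq> snd (line_chart c) ` (fst (line_chart c) \<inter> (U \<times> UNIV) \<inter> \<Psi> -` fst e)"
        by (force simp: s_def)
    qed
    then show "smooth_on ?W (snd e \<circ> s \<circ> chart_inv c)"
      by (rule smooth_on_cong_imp[OF op, rotated]) (auto simp: s_def chart_inv_line_chart[OF cc])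
  qed
  with U right_inv that show ?thesis by blast
qed

lemma bundle_surj:
  assumes "principal_R_bundle A \<psi> V \<mu>"
  obtains a where "\<mu> a = v"
  using bundle_section[OF assms, of v] by metis

lemma smooth_map_from_base:
  fixes V :: "('v::{t2_space,second_countable_topology}, 'ev::euclidean_space) atlas"
    and N :: "('n::{t2_space,second_countable_topology}, 'f::euclidean_space) atlas"
  assumes A: "principal_R_bundle A \<psi> V \<mu>" and N: "smooth_manifold N"
    and g: "smooth_map A N (g \<circ> \<mu>)"
  shows "smooth_map V N g"
proof (rule smooth_map_on_local[OF bundle_smooth(2)[OF A] N])
  fix v
  obtain U s where U: "open U" "v \<in> U" and s: "smooth_map_on V U A s" "\<And>w. w \<in> U \<Longrightarrow> \<mu> (s w) = w"
    using bundle_section[OF A] by metis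
  have "smooth_map_on V U N ((g \<circ> \<mu>) \<circ> s)"
    by (rule smooth_map_on_compose[OF bundle_smooth(2,1)[OF A] N U(1) s(1) g]) auto
  then have "smooth_map_on V U N g"
    by (rule smooth_map_on_cong_imp[OF bundle_smooth(2)[OF A] N U(1), rotated]) (simp add: s(2))
  with U show "\<exists>U. open U \<and> v \<in> U \<and> smooth_map_on V U N g" by blast
qed

text \<open>
  In suitable linear coordinates, given by the derivative of a trivialization, the derivative of
  the bundle projection is the projection that forgets the fibre coordinate.
\<close>

lemma bundle_projection_deriv:
  fixes A :: "('a::{t2_space,second_countable_topology}, 'ea::euclidean_space) atlas"
    and V :: "('v::{t2_space,second_countable_topology}, 'ev::euclidean_space) atlas"
  assumes A: "principal_R_bundle A \<psi> V \<mu>"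
    and c: "c \<in> charts_at A a" and d: "d \<in> charts_at V (\<mu> a)"
  obtains L L' where "linear L" "linear L'" "L \<circ> L' = id" "L' \<circ> L = id"
    "chart_deriv c d \<mu> a = fst \<circ> (L :: 'ea \<Rightarrow> 'ev \<times> real)"
proof -
  obtain U \<Phi> where U: "open U" "\<mu> a \<in> U"
    and \<Phi>: "diffeo_on A (\<mu> -` U) (prod_atlas V real_atlas) (U \<times> UNIV) \<Phi>"
    and fst\<Phi>: "\<And>a. a \<in> \<mu> -` U \<Longrightarrow> fst (\<Phi> a) = \<mu> a"
    using bundle_trivialization[OF A] by metis
  define \<Psi> where "\<Psi> = inv_into (\<mu> -` U) \<Phi>"
  define b where "b = line_chart d"
  define L where "L = chart_deriv c b \<Phi> a"
  define L' where "L' = chart_deriv b c \<Psi> (\<Phi> a)"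
  note cc = charts_at_is_chart[OF bundle_smooth(1)[OF A] c]
  have bb: "is_chart b" unfolding b_def
    by (rule is_chart_line_chart[OF charts_at_is_chart[OF bundle_smooth(2)[OF A] d]])
  have "continuous_on UNIV \<mu>" using bundle_smooth(3)[OF A] by (simp add: smooth_map_on_def)
  then have opU: "open (\<mu> -` U)" using U(1)
    by (metis continuous_on_open_vimage open_UNIV inf_top.right_neutral)
  have bij: "bij_betw \<Phi> (\<mu> -` U) (U \<times> UNIV)" using \<Phi> by (simp add: diffeo_on_def)
  have \<Psi>\<Phi>: "\<Psi> (\<Phi> q) = q" if "q \<in> \<mu> -` U" for q
    using bij_betw_inv_into_left[OF bij that] by (simp add: \<Psi>_def)
  have \<Phi>\<Psi>: "\<Phi> (\<Psi> z) = z" if "z \<in> U \<times> UNIV" for z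
    using bij_betw_inv_into_right[OF bij that] by (simp add: \<Psi>_def)
  have aU: "a \<in> \<mu> -` U" using U by simp
  have \<Phi>a: "\<Phi> a \<in> U \<times> UNIV" using bij_betwE[OF bij] aU by blast
  have bat: "b \<in> charts_at (prod_atlas V real_atlas) (\<Phi> a)"
    using line_chart_mem[of d V] charts_atD[OF d] fst\<Phi>[OF aU]
    by (auto simp: charts_at_def b_def mem_Times_iff)
  have d\<Phi>: "differentiable_map_at A (prod_atlas V real_atlas) \<Phi> a"
    using \<Phi> unfolding diffeo_on_def
    by (intro smooth_map_on_differentiable_map_at[OF _ opU aU]) simp
  have d\<Psi>: "differentiable_map_at (prod_atlas V real_atlas) A \<Psi> (\<Phi> a)"
    using \<Phi> U(1) unfolding diffeo_on_def \<Psi>_def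
    by (intro smooth_map_on_differentiable_map_at[OF _ open_Times \<Phi>a]) simp_all
  have cat: "c \<in> charts_at A (\<Psi> (\<Phi> a))" using c by (simp add: \<Psi>\<Phi>[OF aU])
  have "L' \<circ> L = chart_deriv c c (\<Psi> \<circ> \<Phi>) a"
    using frechet_derivative_at[OF compose_has_chart_deriv[OF cc c bb bat cat d\<Phi> d\<Psi>]]
    by (simp add: chart_deriv_def L_def L'_def)
  also have "\<dots> = chart_deriv c c id a"
    by (rule chart_deriv_cong[OF cc charts_atD(2)[OF c] opU aU]) (simp add: \<Psi>\<Phi>)
  also have "\<dots> = id" by (rule chart_deriv_id_same[OF cc charts_atD(2)[OF c]])
  finally have "L' \<circ> L = id" .
  have bat': "b \<in> charts_at (prod_atlas V real_atlas) (\<Phi> (\<Psi> (\<Phi> a)))"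
    using bat by (simp add: \<Psi>\<Phi>[OF aU])
  have d\<Phi>': "differentiable_map_at A (prod_atlas V real_atlas) \<Phi> (\<Psi> (\<Phi> a))"
    using d\<Phi> by (simp add: \<Psi>\<Phi>[OF aU])
  have "L \<circ> L' = chart_deriv b b (\<Phi> \<circ> \<Psi>) (\<Phi> a)"
    using frechet_derivative_at[OF compose_has_chart_deriv[OF bb bat cc cat bat' d\<Psi> d\<Phi>']]
    by (simp add: chart_deriv_def L_def L'_def \<Psi>\<Phi>[OF aU])
  also have "\<dots> = chart_deriv b b id (\<Phi> a)"
    by (rule chart_deriv_cong[OF bb charts_atD(2)[OF bat] _ \<Phi>a])
      (use U(1) in \<open>simp_all add: open_Times \<Phi>\<Psi>\<close>)
  also have "\<dots> = id" by (rule chart_deriv_id_same[OF bb charts_atD(2)[OF bat]])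
  finally have "L \<circ> L' = id" .
  obtain W where W: "open W" "snd c a \<in> W" "\<And>x. x \<in> W \<Longrightarrow> chart_inv c x \<in> \<mu> -` U \<inter> fst c"
    using chart_nbhd[OF cc charts_atD(2)[OF c] opU aU] by metis
  have "((\<lambda>x. fst ((snd b \<circ> \<Phi> \<circ> chart_inv c) x)) has_derivative (\<lambda>u. fst (L u))) (at (snd c a))"
    unfolding L_def by (intro has_derivative_fst chart_deriv_has_derivative[OF d\<Phi> c bat])
  then have "((snd d \<circ> \<mu> \<circ> chart_inv c) has_derivative (\<lambda>u. fst (L u))) (at (snd c a))"
    by (rule has_derivative_transform_within_open[OF _ W(1,2)])
      (use W(3) fst\<Phi> in \<open>auto simp: b_def\<close>)
  from frechet_derivative_at[OF this] have "chart_deriv c d \<mu> a = fst \<circ> L"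
    by (simp add: chart_deriv_def o_def)
  moreover have "linear L" "linear L'"
    unfolding L_def L'_def using linear_chart_deriv[OF d\<Phi> c bat] linear_chart_deriv[OF d\<Psi> bat cat]
    by auto
  ultimately show ?thesis using that \<open>L' \<circ> L = id\<close> \<open>L \<circ> L' = id\<close> by blast
qed

lemma tangent_projection_surj:
  assumes A: "principal_R_bundle A \<psi> V \<mu>" and Y: "Y \<in> tangent_space V (\<mu> a)"
  obtains X where "X \<in> tangent_space A a" "tangent_map A V \<mu> a X = Y"
proof -
  note M = bundle_smooth(1)[OF A] and N = bundle_smooth(2)[OF A] and D = bundle_differentiable[OF A]
  obtain c where c: "c \<in> charts_at A a" using ex_charts_at[OF M] .
  obtain d where d: "d \<in> charts_at V (\<mu> a)" using ex_charts_at[OF N] .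
  obtain L L' where "linear L" "linear L'" and L: "L \<circ> L' = id" "L' \<circ> L = id"
      "chart_deriv c d \<mu> a = fst \<circ> (L :: _ \<Rightarrow> _ \<times> real)"
    using bundle_projection_deriv[OF A c d] .
  let ?X = "coord_vec A c a (L' (Y d, 0))"
  have "tangent_map A V \<mu> a ?X d = fst ((L \<circ> L') (Y d, 0))"
    using tangent_map_chart[OF M D coord_vec_mem[OF M c] c d] by (simp add: coord_vec_same[OF M c] L(3))
  then have "tangent_map A V \<mu> a ?X = Y"
    by (intro tangent_eqI[OF tangent_map_mem[OF M N D coord_vec_mem[OF M c]] Y d]) (simp add: L(1))
  with coord_vec_mem[OF M c] show ?thesis by (rule that)
qed

text \<open>The vertical tangent vectors form a line.\<close>

lemma vertical_line:
  assumes A: "principal_R_bundle A \<psi> V \<mu>"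
  obtains Z where "Z \<in> tangent_space A a" "Z \<noteq> (\<lambda>_. 0)" "tangent_map A V \<mu> a Z = (\<lambda>_. 0)"
    "\<And>X. X \<in> tangent_space A a \<Longrightarrow> tangent_map A V \<mu> a X = (\<lambda>_. 0) \<Longrightarrow> \<exists>r. X = lincomb r Z 0 Z"
proof -
  note M = bundle_smooth(1)[OF A] and N = bundle_smooth(2)[OF A] and D = bundle_differentiable[OF A]
  obtain c where c: "c \<in> charts_at A a" using ex_charts_at[OF M] .
  obtain d where d: "d \<in> charts_at V (\<mu> a)" using ex_charts_at[OF N] .
  obtain L L' where lin: "linear L" "linear L'" and L: "L \<circ> L' = id" "L' \<circ> L = id"
      "chart_deriv c d \<mu> a = fst \<circ> (L :: _ \<Rightarrow> _ \<times> real)"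
    using bundle_projection_deriv[OF A c d] .
  have LL': "L (L' z) = z" "L' (L u) = u" for z u
    using fun_cong[OF L(1), of z] fun_cong[OF L(2), of u] by simp_all
  let ?z = "L' (0, 1)"
  let ?Z = "coord_vec A c a ?z"
  note Z = coord_vec_mem[OF M c, of ?z]
  have comp: "tangent_map A V \<mu> a X d = fst (L (X c))" if "X \<in> tangent_space A a" for X
    using tangent_map_chart[OF M D that c d] by (simp add: L(3))
  show ?thesis
  proof
    show "?Z \<in> tangent_space A a" by (rule Z)
    show "?Z \<noteq> (\<lambda>_. 0)"
    proof
      assume "?Z = (\<lambda>_. 0)"
      then have "?z = 0" using coord_vec_same[OF M c, of ?z] by simp
      then show False using LL'(1)[of "(0, 1)"] linear_0[OF lin(1)] by (simp add: zero_prod_def)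
    qed
    show "tangent_map A V \<mu> a ?Z = (\<lambda>_. 0)"
      by (rule tangent_eqI[OF tangent_map_mem[OF M N D Z] zero_mem_tangent_space[OF N] d])
        (simp add: comp[OF Z] coord_vec_same[OF M c] LL')
    fix X assume X: "X \<in> tangent_space A a" and "tangent_map A V \<mu> a X = (\<lambda>_. 0)"
    then have "fst (L (X c)) = 0" using comp[OF X] by simp
    then have "L (X c) = snd (L (X c)) *\<^sub>R (0, 1)" by (simp add: prod_eq_iff)
    then have "X c = snd (L (X c)) *\<^sub>R ?z" using LL'(2)[of "X c"] linear_scale[OF lin(2)] by metis
    then have "X = lincomb (snd (L (X c))) ?Z 0 ?Z"
      by (intro tangent_eqI[OF X lincomb_mem_tangent_space[OF M Z Z] c])
        (simp add: lincomb_def coord_vec_same[OF M c])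
    then show "\<exists>r. X = lincomb r ?Z 0 ?Z" ..
  qed
qed

section \<open>Symplectic linear algebra on tangent spaces\<close>

lemma linear_form_onD:
  "linear_form_on S g \<Longrightarrow> x \<in> S \<Longrightarrow> y \<in> S \<Longrightarrow> g (lincomb r x s y) = r * g x + s * g y"
  by (simp add: linear_form_on_def)

lemma skew_bilinear_form_onD:
  assumes "skew_bilinear_form_on S B" "x \<in> S"
  shows "linear_form_on S (B x)" "linear_form_on S (\<lambda>y. B y x)" "y \<in> S \<Longrightarrow> B x y = - B y x"
  using assms unfolding skew_bilinear_form_on_def by blast+

lemma skew_bilinear_lincomb:
  assumes "skew_bilinear_form_on S B" "x \<in> S" "y \<in> S" "z \<in> S"
  shows "B (lincomb r x s y) z = r * B x z + s * B y z"
    and "B z (lincomb r x s y) = r * B z x + s * B z y"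
  using linear_form_onD[OF skew_bilinear_form_onD(1)[OF assms(1,4)] assms(2,3)]
    linear_form_onD[OF skew_bilinear_form_onD(2)[OF assms(1,4)] assms(2,3)] by simp_all

text \<open>A nondegenerate form on a finite-dimensional space represents all linear functionals.\<close>

lemma nondegenerate_represents:
  assumes M: "smooth_manifold M" and B: "skew_bilinear_form_on (tangent_space M p) B"
    and nondeg: "\<And>X. X \<in> tangent_space M p \<Longrightarrow> (\<forall>Y\<in>tangent_space M p. B X Y = 0) \<Longrightarrow> X = (\<lambda>_. 0)"
    and g: "linear_form_on (tangent_space M p) g"
  obtains X where "X \<in> tangent_space M p" "\<And>Y. Y \<in> tangent_space M p \<Longrightarrow> B X Y = g Y"
proof -
  obtain c where c: "c \<in> charts_at M p" using ex_charts_at[OF M] .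
  let ?i = "coord_vec M c p"
  note i = coord_vec_mem[OF M c]
  have expand: "h Y = (\<Sum>b\<in>Basis. (Y c \<bullet> b) * h (?i b))"
    if h: "linear_form_on (tangent_space M p) h" and Y: "Y \<in> tangent_space M p" for h Y
  proof -
    interpret h: linear "\<lambda>u. h (?i u)" by (rule linear_form_coord_vec[OF M c h])
    have "h Y = h (?i (\<Sum>b\<in>Basis. (Y c \<bullet> b) *\<^sub>R b))"
      by (simp only: euclidean_representation coord_vec_eq[OF M c Y])
    also have "\<dots> = (\<Sum>b\<in>Basis. (Y c \<bullet> b) * h (?i b))"
      by (simp only: h.sum h.scaleR real_scaleR_def)
    finally show ?thesis .
  qed
  note linB = skew_bilinear_form_onD(1)[OF B] and linB' = skew_bilinear_form_onD(2)[OF B]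
  define F where "F u = (\<Sum>b\<in>Basis. B (?i u) (?i b) *\<^sub>R b)" for u
  have "linear F"
    unfolding F_def
  proof (intro linear_compose_sum ballI)
    fix b :: 'b
    have "linear (\<lambda>u. B (?i u) (?i b))" by (rule linear_form_coord_vec[OF M c linB'[OF i]])
    from linear_compose[OF this linear_scaleR_left[of b]]
    show "linear (\<lambda>u. B (?i u) (?i b) *\<^sub>R b)" by (simp add: o_def)
  qed
  have F_inner: "F u \<bullet> b = B (?i u) (?i b)" if "b \<in> Basis" for u b
    unfolding F_def using that by (simp add: inner_sum_left inner_Basis if_distrib sum.delta cong: if_cong)
  have "u = 0" if "F u = 0" for u
  proof -
    have "\<forall>Y\<in>tangent_space M p. B (?i u) Y = 0"
    proof
      fix Y assume Y: "Y \<in> tangent_space M p"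
      have "B (?i u) (?i b) = 0" if "b \<in> Basis" for b
        using F_inner[OF that, of u] \<open>F u = 0\<close> by simp
      then show "B (?i u) Y = 0" using expand[OF linB[OF i] Y] by simp
    qed
    from nondeg[OF i this] show "u = 0" using coord_vec_same[OF M c, of u] by simp
  qed
  then have "inj F" using linear_injective_0[OF \<open>linear F\<close>] by blast
  with \<open>linear F\<close> have "surj F" by (rule linear_inj_imp_surj)
  then obtain u where u: "F u = (\<Sum>b\<in>Basis. g (?i b) *\<^sub>R b)" by (metis surjD)
  have "B (?i u) (?i b) = g (?i b)" if "b \<in> Basis" for b
    using F_inner[OF that, of u] that unfolding u
    by (simp add: inner_sum_left inner_Basis if_distrib sum.delta cong: if_cong)
  then have "B (?i u) Y = g Y" if "Y \<in> tangent_space M p" for Y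
    using expand[OF linB[OF i] that] expand[OF g that] by simp
  with i show ?thesis by (rule that)
qed


text \<open>
  The tangent vector \<open>X\<close> represents the functional \<open>g\<close> by \<open>i\<^bsub>X\<^esub> \<Omega> = g\<close>; for \<open>g = dF\<close> it is the
  Hamiltonian vector of \<open>F\<close>.
\<close>

definition represents ::
  "('m, 'e::euclidean_space) atlas \<Rightarrow> ('m, 'e) form2 \<Rightarrow> 'm \<Rightarrow> ('m, 'e) tvec
    \<Rightarrow> (('m, 'e) tvec \<Rightarrow> real) \<Rightarrow> bool" where
  "represents M \<Omega> p X g \<longleftrightarrow> X \<in> tangent_space M p \<and> (\<forall>Y\<in>tangent_space M p. \<Omega> p X Y = g Y)"

lemma symplectic_formD:
  assumes "symplectic_form M \<Omega>"
  shows "skew_bilinear_form_on (tangent_space M p) (\<Omega> p)"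
    and "X \<in> tangent_space M p \<Longrightarrow> (\<And>Y. Y \<in> tangent_space M p \<Longrightarrow> \<Omega> p X Y = 0) \<Longrightarrow> X = (\<lambda>_. 0)"
  using assms unfolding symplectic_form_def by blast+

lemma symplectic_represents_exists:
  assumes M: "smooth_manifold M" and \<Omega>: "symplectic_form M \<Omega>"
    and g: "linear_form_on (tangent_space M p) g"
  obtains X where "represents M \<Omega> p X g"
  using nondegenerate_represents[OF M symplectic_formD(1)[OF \<Omega>] _ g] symplectic_formD(2)[OF \<Omega>]
  unfolding represents_def by metis

lemma symplectic_represents_unique:
  assumes M: "smooth_manifold M" and \<Omega>: "symplectic_form M \<Omega>"
    and X: "represents M \<Omega> p X g" and Y: "represents M \<Omega> p Y g"
  shows "X = Y"
proof -
  let ?D = "lincomb 1 X (- 1) Y"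
  have XT: "X \<in> tangent_space M p" and YT: "Y \<in> tangent_space M p"
    using X Y by (simp_all add: represents_def)
  have "\<Omega> p ?D W = 0" if "W \<in> tangent_space M p" for W
    using X Y that skew_bilinear_lincomb(1)[OF symplectic_formD(1)[OF \<Omega>] XT YT that, of 1 "- 1"]
    by (simp add: represents_def)
  then have "?D = (\<lambda>_. 0)"
    by (rule symplectic_formD(2)[OF \<Omega> lincomb_mem_tangent_space[OF M XT YT]])
  then show ?thesis by (simp add: lincomb_def fun_eq_iff)
qed

lemma hamiltonian_vec_eq:
  assumes "smooth_manifold M" "symplectic_form M \<Omega>" "represents M \<Omega> p X (differential M F p)"
  shows "hamiltonian_vec M \<Omega> F p = X"
  unfolding hamiltonian_vec_def
proof (rule the_equality)
  fix Y assume "Y \<in> tangent_space M p \<and> (\<forall>Z\<in>tangent_space M p. \<Omega> p Y Z = differential M F p Z)"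
  then have "represents M \<Omega> p Y (differential M F p)" by (simp add: represents_def)
  then show "Y = X" using assms(3) by (rule symplectic_represents_unique[OF assms(1,2)])
qed (use assms(3) in \<open>simp add: represents_def\<close>)

text \<open>
  The Poisson structure induced on the base, as a formula for arbitrary covectors: every covector
  is the differential of a function, and the Hamiltonian vectors of the pulled-back functions
  represent the pulled-back covectors.
\<close>

lemma induced_poisson_structure_eq:
  fixes V :: "('v::{t2_space,second_countable_topology}, 'ev::euclidean_space) atlas"
  assumes A: "principal_R_bundle A \<psi> V \<mu>" and \<Omega>: "symplectic_form A \<Omega>"
    and \<Lambda>: "induced_poisson_structure A \<Omega> V \<mu> \<Lambda>"
    and \<sigma>: "\<sigma>1 \<in> cotangent_space V (\<mu> a)" "\<sigma>2 \<in> cotangent_space V (\<mu> a)"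
    and X1: "represents A \<Omega> a X1 (\<lambda>Y. \<sigma>1 (tangent_map A V \<mu> a Y))"
    and X2: "represents A \<Omega> a X2 (\<lambda>Y. \<sigma>2 (tangent_map A V \<mu> a Y))"
  shows "\<Lambda> (\<mu> a) \<sigma>1 \<sigma>2 = \<Omega> a X1 X2"
proof -
  note M = bundle_smooth(1)[OF A] and N = bundle_smooth(2)[OF A] and D = bundle_differentiable[OF A]
  obtain f1 where f1: "smooth_fun V f1" "differential V f1 (\<mu> a) = \<sigma>1"
    using covector_is_differential[OF N \<sigma>(1)] .
  obtain f2 where f2: "smooth_fun V f2" "differential V f2 (\<mu> a) = \<sigma>2"
    using covector_is_differential[OF N \<sigma>(2)] .
  have ham: "hamiltonian_vec A \<Omega> (f \<circ> \<mu>) a = X"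
    if f: "smooth_fun V f"
      and X: "represents A \<Omega> a X (\<lambda>Y. differential V f (\<mu> a) (tangent_map A V \<mu> a Y))"
    for f X
  proof (rule hamiltonian_vec_eq[OF M \<Omega>])
    show "represents A \<Omega> a X (differential A (f \<circ> \<mu>) a)"
      using X differential_compose[OF M N D smooth_map_differentiable_map_at[OF f]]
      by (simp add: represents_def pullback_covec_def)
  qed
  have "symplectic_bracket A \<Omega> (f1 \<circ> \<mu>) (f2 \<circ> \<mu>) = bivec_bracket V \<Lambda> f1 f2 \<circ> \<mu>"
    using \<Lambda> f1(1) f2(1) by (simp add: induced_poisson_structure_def poisson_map_def)
  from fun_cong[OF this, of a] show ?thesis
    using ham[OF f1(1)] ham[OF f2(1)] X1 X2
    by (simp add: symplectic_bracket_def bivec_bracket_def f1(2) f2(2))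
qed

section \<open>Morphisms of symplectic principal bundles\<close>

text \<open>
  A map \<open>\<phi>\<close> of total spaces that covers a map \<open>\<phi>V\<close> of bases and pulls back \<open>\<Omega>'\<close> to \<open>\<Omega>\<close>. Its
  tangent maps are injective because \<open>\<Omega>\<close> is nondegenerate.
\<close>

locale symplectic_bundle_morphism =
  fixes A :: "('a::{t2_space,second_countable_topology}, 'ea::euclidean_space) atlas"
    and V :: "('v::{t2_space,second_countable_topology}, 'ev::euclidean_space) atlas"
    and A' :: "('b::{t2_space,second_countable_topology}, 'eb::euclidean_space) atlas"
    and V' :: "('w::{t2_space,second_countable_topology}, 'ew::euclidean_space) atlas"
    and \<Omega> :: "('a, 'ea) form2" and \<Omega>' :: "('b, 'eb) form2"
    and \<psi> :: "real \<Rightarrow> 'a \<Rightarrow> 'a" and \<psi>' :: "real \<Rightarrow> 'b \<Rightarrow> 'b"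
    and \<mu> :: "'a \<Rightarrow> 'v" and \<mu>' :: "'b \<Rightarrow> 'w"
    and \<phi> :: "'a \<Rightarrow> 'b" and \<phi>V :: "'v \<Rightarrow> 'w"
    and \<Lambda> :: "('v, 'ev) bivec" and \<Lambda>' :: "('w, 'ew) bivec"
  assumes prin: "principal_R_bundle A \<psi> V \<mu>" and prin': "principal_R_bundle A' \<psi>' V' \<mu>'"
    and \<Omega>: "symplectic_form A \<Omega>" and \<Omega>': "symplectic_form A' \<Omega>'"
    and \<Lambda>: "induced_poisson_structure A \<Omega> V \<mu> \<Lambda>"
    and \<Lambda>': "induced_poisson_structure A' \<Omega>' V' \<mu>' \<Lambda>'"
    and comm: "\<mu>' \<circ> \<phi> = \<phi>V \<circ> \<mu>"
    and smooth: "smooth_map A A' \<phi>"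
    and pullback: "pulls_back_form A \<Omega> A' \<Omega>' \<phi>"
begin

lemmas A = bundle_smooth(1)[OF prin] and V = bundle_smooth(2)[OF prin]
  and A' = bundle_smooth(1)[OF prin'] and V' = bundle_smooth(2)[OF prin']

lemma comm_apply: "\<mu>' (\<phi> a) = \<phi>V (\<mu> a)"
  using comm by (simp add: fun_eq_iff)

lemma smooth_base: "smooth_map V V' \<phi>V"
proof (rule smooth_map_from_base[OF prin V'])
  have "smooth_map A V' (\<mu>' \<circ> \<phi>)"
    using smooth bundle_smooth(3)[OF prin']
    by (rule smooth_map_on_compose[OF A A' V' open_UNIV]) simp
  then show "smooth_map A V' (\<phi>V \<circ> \<mu>)" by (simp add: comm)
qed

context
  fixes a :: 'a
begin

abbreviation (input) "T \<equiv> tangent_space A a"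
abbreviation (input) "T' \<equiv> tangent_space A' (\<phi> a)"
abbreviation (input) "D\<mu> \<equiv> tangent_map A V \<mu> a"
abbreviation (input) "D\<mu>' \<equiv> tangent_map A' V' \<mu>' (\<phi> a)"
abbreviation (input) "D\<phi> \<equiv> tangent_map A A' \<phi> a"
abbreviation (input) "D\<phi>V \<equiv> tangent_map V V' \<phi>V (\<mu> a)"

text \<open>The covectors at \<open>\<phi>V (\<mu> a)\<close> that annihilate the image of the tangent space at \<open>\<mu> a\<close>.\<close>

abbreviation (input) "P \<equiv> annihilator V' (\<phi>V (\<mu> a)) (D\<phi>V ` tangent_space V (\<mu> a))"

lemma d\<mu>: "differentiable_map_at A V \<mu> a"
  by (rule bundle_differentiable[OF prin])

lemma d\<mu>': "differentiable_map_at A' V' \<mu>' (\<phi> a)"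
  by (rule bundle_differentiable[OF prin'])

lemma d\<phi>: "differentiable_map_at A A' \<phi> a"
  by (rule smooth_map_differentiable_map_at[OF smooth])

lemma d\<phi>V: "differentiable_map_at V V' \<phi>V (\<mu> a)"
  by (rule smooth_map_differentiable_map_at[OF smooth_base])

lemma D\<phi>_mem: "X \<in> T \<Longrightarrow> D\<phi> X \<in> T'"
  by (rule tangent_map_mem[OF A A' d\<phi>])

lemma D\<mu>_mem: "X \<in> T \<Longrightarrow> D\<mu> X \<in> tangent_space V (\<mu> a)"
  by (rule tangent_map_mem[OF A V d\<mu>])

lemma D\<mu>'_mem: "X \<in> T' \<Longrightarrow> D\<mu>' X \<in> tangent_space V' (\<phi>V (\<mu> a))"
  using tangent_map_mem[OF A' V' d\<mu>'] by (simp add: comm_apply)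

lemma square: "X \<in> T \<Longrightarrow> D\<phi>V (D\<mu> X) = D\<mu>' (D\<phi> X)"
  using tangent_map_compose[OF A V d\<mu> d\<phi>V] tangent_map_compose[OF A A' d\<phi> d\<mu>'] by (simp add: comm)

lemma \<Omega>_D\<phi>: "X \<in> T \<Longrightarrow> Y \<in> T \<Longrightarrow> \<Omega>' (\<phi> a) (D\<phi> X) (D\<phi> Y) = \<Omega> a X Y"
  using pullback by (simp add: pulls_back_form_def)

lemmas \<Omega>'_lincomb = skew_bilinear_lincomb[OF symplectic_formD(1)[OF \<Omega>'], of _ "\<phi> a"]

lemma \<Omega>'_skew: "X \<in> T' \<Longrightarrow> Y \<in> T' \<Longrightarrow> \<Omega>' (\<phi> a) X Y = - \<Omega>' (\<phi> a) Y X"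
  by (rule skew_bilinear_form_onD(3)[OF symplectic_formD(1)[OF \<Omega>']])

lemma linear_form_D\<mu>':
  "\<sigma> \<in> cotangent_space V' (\<phi>V (\<mu> a)) \<Longrightarrow> linear_form_on T' (\<lambda>Y. \<sigma> (D\<mu>' Y))"
  by (rule linear_form_pullback[OF A' V' d\<mu>']) (simp add: cotangent_space_def comm_apply)

lemma D\<phi>_eq_0: assumes X: "X \<in> T" and "D\<phi> X = (\<lambda>_. 0)" shows "X = (\<lambda>_. 0)"
proof (rule symplectic_formD(2)[OF \<Omega> X])
  fix Y assume Y: "Y \<in> T"
  have "lincomb 0 (D\<phi> X) 0 (D\<phi> X) = D\<phi> X" using assms(2) by (simp add: lincomb_def)
  then show "\<Omega> a X Y = 0"
    using \<Omega>'_lincomb(1)[OF D\<phi>_mem[OF X] D\<phi>_mem[OF X] D\<phi>_mem[OF Y], of 0 0] \<Omega>_D\<phi>[OF X Y] by simp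
qed

text \<open>
  Vertical vectors of the target lie in the image of \<open>D\<phi>\<close>, since \<open>D\<phi>\<close> embeds one vertical line
  into the other.
\<close>

lemma vertical_in_image:
  assumes X': "X' \<in> T'" and vert: "D\<mu>' X' = (\<lambda>_. 0)"
  obtains X where "X \<in> T" "X' = D\<phi> X"
proof -
  obtain Z where Z: "Z \<in> T" "Z \<noteq> (\<lambda>_. 0)" "D\<mu> Z = (\<lambda>_. 0)"
    using vertical_line[OF prin] by metis
  obtain Z' where Z': "\<And>X. X \<in> T' \<Longrightarrow> D\<mu>' X = (\<lambda>_. 0) \<Longrightarrow> \<exists>r. X = lincomb r Z' 0 Z'"
    using vertical_line[OF prin'] by metis
  have "D\<mu> (lincomb 0 Z 0 Z) = (\<lambda>_. 0)" "D\<phi>V (\<lambda>_. 0) = (\<lambda>_. 0)"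
    using tangent_map_lincomb[OF A d\<mu> Z(1) Z(1), of 0 0]
      tangent_map_lincomb[OF V d\<phi>V zero_mem_tangent_space[OF V] zero_mem_tangent_space[OF V], of 0 0]
    by (simp_all add: lincomb_def)
  then have "D\<mu>' (D\<phi> Z) = (\<lambda>_. 0)" using square[OF Z(1)] Z(3) by simp
  then obtain r where r: "D\<phi> Z = lincomb r Z' 0 Z'" using Z'[OF D\<phi>_mem[OF Z(1)]] by blast
  have "D\<phi> Z \<noteq> (\<lambda>_. 0)" using D\<phi>_eq_0[OF Z(1)] Z(2) by blast
  then have "r \<noteq> 0" using r by (auto simp: lincomb_def)
  obtain s where s: "X' = lincomb s Z' 0 Z'" using Z'[OF X' vert] by blast
  have "X' = lincomb (s / r) (D\<phi> Z) 0 (D\<phi> Z)"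
    using \<open>r \<noteq> 0\<close> unfolding r s by (simp add: lincomb_def)
  also have "\<dots> = D\<phi> (lincomb (s / r) Z 0 Z)"
    by (rule tangent_map_lincomb[OF A d\<phi> Z(1) Z(1), symmetric])
  finally show ?thesis using lincomb_mem_tangent_space[OF A Z(1) Z(1)] that by blast
qed

text \<open>The image of \<open>D\<phi>\<close> and its symplectic complement span the tangent space of the target.\<close>

lemma symplectic_splitting:
  assumes X': "X' \<in> T'"
  obtains X N where "X \<in> T" "N \<in> T'" "X' = lincomb 1 (D\<phi> X) 1 N"
    "\<And>Y. Y \<in> T \<Longrightarrow> \<Omega>' (\<phi> a) N (D\<phi> Y) = 0"
proof -
  have "linear_form_on T (\<lambda>Y. \<Omega>' (\<phi> a) X' (D\<phi> Y))"
    by (rule linear_form_pullback[OF A A' d\<phi>])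
      (rule skew_bilinear_form_onD(1)[OF symplectic_formD(1)[OF \<Omega>'] X'])
  then obtain X where "represents A \<Omega> a X (\<lambda>Y. \<Omega>' (\<phi> a) X' (D\<phi> Y))"
    using symplectic_represents_exists[OF A \<Omega>] by blast
  then have X: "X \<in> T" "\<And>Y. Y \<in> T \<Longrightarrow> \<Omega> a X Y = \<Omega>' (\<phi> a) X' (D\<phi> Y)"
    by (simp_all add: represents_def)
  let ?N = "lincomb 1 X' (- 1) (D\<phi> X)"
  show ?thesis
  proof
    show "X \<in> T" by (rule X(1))
    show "?N \<in> T'" by (rule lincomb_mem_tangent_space[OF A' X' D\<phi>_mem[OF X(1)]])
    show "X' = lincomb 1 (D\<phi> X) 1 ?N" by (simp add: lincomb_def)
    show "\<Omega>' (\<phi> a) ?N (D\<phi> Y) = 0" if "Y \<in> T" for Y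
      using \<Omega>'_lincomb(1)[OF X' D\<phi>_mem[OF X(1)] D\<phi>_mem[OF that], of 1 "- 1"]
        X(2)[OF that] \<Omega>_D\<phi>[OF X(1) that] by simp
  qed
qed

text \<open>
  The symplectic complement of the image of \<open>D\<phi>\<close> corresponds to \<open>P\<close>: a vector orthogonal to the
  image is orthogonal to the vertical line, so the functional that it represents descends to the
  base.
\<close>

lemma orthogonal_represents_annihilator:
  assumes N: "N \<in> T'" and orth: "\<And>Y. Y \<in> T \<Longrightarrow> \<Omega>' (\<phi> a) N (D\<phi> Y) = 0"
  obtains \<tau> where "\<tau> \<in> P" "represents A' \<Omega>' (\<phi> a) N (\<lambda>Y. \<tau> (D\<mu>' Y))"
proof -
  let ?v = "\<phi>V (\<mu> a)"
  define \<tau> where "\<tau> Y = (if Y \<in> tangent_space V' ?v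
    then \<Omega>' (\<phi> a) N (SOME X. X \<in> T' \<and> D\<mu>' X = Y) else 0)" for Y
  have \<tau>: "\<tau> (D\<mu>' X) = \<Omega>' (\<phi> a) N X" if X: "X \<in> T'" for X
  proof -
    define X0 where "X0 = (SOME X0. X0 \<in> T' \<and> D\<mu>' X0 = D\<mu>' X)"
    have X0: "X0 \<in> T'" "D\<mu>' X0 = D\<mu>' X"
      unfolding X0_def using someI[of "\<lambda>X0. X0 \<in> T' \<and> D\<mu>' X0 = D\<mu>' X" X] X by auto
    have "D\<mu>' (lincomb 1 X0 (- 1) X) = (\<lambda>_. 0)"
      unfolding tangent_map_lincomb[OF A' d\<mu>' X0(1) X] X0(2) by (simp add: lincomb_def)
    then obtain Y where Y: "Y \<in> T" "lincomb 1 X0 (- 1) X = D\<phi> Y"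
      using vertical_in_image[OF lincomb_mem_tangent_space[OF A' X0(1) X]] by metis
    have "\<Omega>' (\<phi> a) N X0 = \<Omega>' (\<phi> a) N X"
      using \<Omega>'_lincomb(2)[OF X0(1) X N, of 1 "- 1"] orth[OF Y(1)] Y(2) by simp
    then show ?thesis using D\<mu>'_mem[OF X] by (simp add: \<tau>_def X0_def)
  qed
  have surj: "\<exists>X\<in>T'. D\<mu>' X = Y" if "Y \<in> tangent_space V' ?v" for Y
    using tangent_projection_surj[OF prin', of Y "\<phi> a"] that unfolding comm_apply by metis
  have "linear_form_on (tangent_space V' ?v) \<tau>"
    unfolding linear_form_on_def
  proof (intro ballI allI)
    fix Y1 Y2 r s assume "Y1 \<in> tangent_space V' ?v" "Y2 \<in> tangent_space V' ?v"
    then obtain X1 X2 where X: "X1 \<in> T'" "D\<mu>' X1 = Y1" "X2 \<in> T'" "D\<mu>' X2 = Y2"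
      using surj by metis
    have "\<tau> (D\<mu>' (lincomb r X1 s X2)) = r * \<tau> (D\<mu>' X1) + s * \<tau> (D\<mu>' X2)"
      using \<tau>[OF X(1)] \<tau>[OF X(3)] \<tau>[OF lincomb_mem_tangent_space[OF A' X(1,3)]]
        \<Omega>'_lincomb(2)[OF X(1,3) N] by simp
    then show "\<tau> (lincomb r Y1 s Y2) = r * \<tau> Y1 + s * \<tau> Y2"
      using tangent_map_lincomb[OF A' d\<mu>' X(1,3)] X(2,4) by simp
  qed
  then have "\<tau> \<in> cotangent_space V' ?v" by (simp add: cotangent_space_def \<tau>_def)
  moreover have "\<tau> (D\<phi>V Y) = 0" if Y: "Y \<in> tangent_space V (\<mu> a)" for Y
  proof -
    obtain X where X: "X \<in> T" "D\<mu> X = Y" using tangent_projection_surj[OF prin Y] .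
    then show ?thesis using square[OF X(1)] \<tau>[OF D\<phi>_mem[OF X(1)]] orth[OF X(1)] by simp
  qed
  ultimately have "\<tau> \<in> P" by (auto simp: annihilator_def)
  moreover have "represents A' \<Omega>' (\<phi> a) N (\<lambda>Y. \<tau> (D\<mu>' Y))"
    using N \<tau> by (simp add: represents_def)
  ultimately show ?thesis by (rule that)
qed

lemma annihilator_represented_orthogonal:
  assumes "\<tau> \<in> P" "represents A' \<Omega>' (\<phi> a) N (\<lambda>Y. \<tau> (D\<mu>' Y))" "Y \<in> T"
  shows "\<Omega>' (\<phi> a) N (D\<phi> Y) = 0"
proof -
  have "\<Omega>' (\<phi> a) N (D\<phi> Y) = \<tau> (D\<phi>V (D\<mu> Y))"
    using assms(2,3) D\<phi>_mem square by (simp add: represents_def)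
  then show ?thesis using assms(1) D\<mu>_mem[OF assms(3)] by (simp add: annihilator_def)
qed

lemma \<Lambda>'_eq:
  assumes "\<sigma>1 \<in> cotangent_space V' (\<phi>V (\<mu> a))" "\<sigma>2 \<in> cotangent_space V' (\<phi>V (\<mu> a))"
    and "represents A' \<Omega>' (\<phi> a) X1 (\<lambda>Y. \<sigma>1 (D\<mu>' Y))"
    and "represents A' \<Omega>' (\<phi> a) X2 (\<lambda>Y. \<sigma>2 (D\<mu>' Y))"
  shows "\<Lambda>' (\<phi>V (\<mu> a)) \<sigma>1 \<sigma>2 = \<Omega>' (\<phi> a) X1 X2"
  using induced_poisson_structure_eq[OF prin' \<Omega>' \<Lambda>', of \<sigma>1 "\<phi> a" \<sigma>2 X1 X2] assms
  by (simp add: comm_apply)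

lemma represents_exists:
  assumes "\<sigma> \<in> cotangent_space V' (\<phi>V (\<mu> a))"
  obtains X where "represents A' \<Omega>' (\<phi> a) X (\<lambda>Y. \<sigma> (D\<mu>' Y))"
  using symplectic_represents_exists[OF A' \<Omega>' linear_form_D\<mu>'[OF assms]] .

lemma sharp_eq:
  assumes \<alpha>: "\<alpha> \<in> cotangent_space V' (\<phi>V (\<mu> a))"
    and X: "represents A' \<Omega>' (\<phi> a) X (\<lambda>Y. \<alpha> (D\<mu>' Y))"
  shows "sharp V' \<Lambda>' (\<phi>V (\<mu> a)) \<alpha> = D\<mu>' X"
proof -
  have XT: "X \<in> T'" using X by (simp add: represents_def)
  have eq: "\<beta> (D\<mu>' X) = \<Lambda>' (\<phi>V (\<mu> a)) \<beta> \<alpha>" if \<beta>: "\<beta> \<in> cotangent_space V' (\<phi>V (\<mu> a))" for \<beta>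
  proof -
    obtain W where W: "represents A' \<Omega>' (\<phi> a) W (\<lambda>Y. \<beta> (D\<mu>' Y))" using represents_exists[OF \<beta>] .
    then show ?thesis using \<Lambda>'_eq[OF \<beta> \<alpha> W X] XT by (simp add: represents_def)
  qed
  show ?thesis
    unfolding sharp_def
  proof (rule the_equality)
    fix Y assume "Y \<in> tangent_space V' (\<phi>V (\<mu> a))
      \<and> (\<forall>\<beta>\<in>cotangent_space V' (\<phi>V (\<mu> a)). \<beta> Y = \<Lambda>' (\<phi>V (\<mu> a)) \<beta> \<alpha>)"
    then show "Y = D\<mu>' X"
      by (intro tangent_eq_covecI[OF V' _ D\<mu>'_mem[OF XT]]) (auto simp: eq)
  qed (use D\<mu>'_mem[OF XT] eq in auto)
qed

lemma covector_diff_mem: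
  assumes "\<sigma> \<in> cotangent_space V' v" "\<tau> \<in> cotangent_space V' v"
  shows "(\<lambda>Y. \<sigma> Y - \<tau> Y) \<in> cotangent_space V' v"
  using assms by (auto simp: cotangent_space_def linear_form_on_def algebra_simps)

text \<open>
  On representing vectors, \<open>q_tilde\<close> is the projection to the symplectic complement of the image of
  \<open>D\<phi>\<close>.
\<close>

lemma q_tilde_eq:
  assumes \<sigma>: "\<sigma> \<in> cotangent_space V' (\<phi>V (\<mu> a))"
    and X: "X \<in> T" and N: "represents A' \<Omega>' (\<phi> a) N (\<lambda>Y. \<tau> (D\<mu>' Y))" and \<tau>: "\<tau> \<in> P"
    and rep: "represents A' \<Omega>' (\<phi> a) (lincomb 1 (D\<phi> X) 1 N) (\<lambda>Y. \<sigma> (D\<mu>' Y))"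
  shows "q_tilde V V' \<Lambda>' \<phi>V (\<mu> a) \<sigma> = \<tau>"
proof -
  let ?v = "\<phi>V (\<mu> a)"
  have P_cot: "\<alpha> \<in> cotangent_space V' ?v" if "\<alpha> \<in> P" for \<alpha> using that by (simp add: annihilator_def)
  have NT: "N \<in> T'" using N by (simp add: represents_def)
  let ?Q = "annihilator V' ?v (sharp V' \<Lambda>' ?v ` P)"
  have Q_iff: "\<delta> \<in> ?Q \<longleftrightarrow> (\<forall>\<alpha>\<in>P. \<forall>X. represents A' \<Omega>' (\<phi> a) X (\<lambda>Y. \<alpha> (D\<mu>' Y)) \<longrightarrow> \<delta> (D\<mu>' X) = 0)"
    if \<delta>: "\<delta> \<in> cotangent_space V' ?v" for \<delta>
  proof
    assume "\<delta> \<in> ?Q"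
    then show "\<forall>\<alpha>\<in>P. \<forall>X. represents A' \<Omega>' (\<phi> a) X (\<lambda>Y. \<alpha> (D\<mu>' Y)) \<longrightarrow> \<delta> (D\<mu>' X) = 0"
      using sharp_eq P_cot unfolding annihilator_def[of V' ?v "sharp V' \<Lambda>' ?v ` P"] by force
  next
    assume *: "\<forall>\<alpha>\<in>P. \<forall>X. represents A' \<Omega>' (\<phi> a) X (\<lambda>Y. \<alpha> (D\<mu>' Y)) \<longrightarrow> \<delta> (D\<mu>' X) = 0"
    have "\<delta> (sharp V' \<Lambda>' ?v \<alpha>) = 0" if \<alpha>: "\<alpha> \<in> P" for \<alpha>
    proof -
      obtain W where "represents A' \<Omega>' (\<phi> a) W (\<lambda>Y. \<alpha> (D\<mu>' Y))"
        using represents_exists[OF P_cot[OF \<alpha>]] .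
      then show ?thesis using * \<alpha> sharp_eq[OF P_cot[OF \<alpha>]] by simp
    qed
    then show "\<delta> \<in> ?Q" using \<delta> unfolding annihilator_def[of V' ?v "sharp V' \<Lambda>' ?v ` P"] by blast
  qed
  have agree: "\<sigma> (D\<mu>' W) = \<tau> (D\<mu>' W)" if W: "W \<in> T'" and orth: "\<Omega>' (\<phi> a) W (D\<phi> X) = 0" for W
  proof -
    have "\<sigma> (D\<mu>' W) - \<tau> (D\<mu>' W) = \<Omega>' (\<phi> a) (lincomb 1 (D\<phi> X) 1 N) W - \<Omega>' (\<phi> a) N W"
      using rep N W by (simp add: represents_def)
    also have "\<dots> = \<Omega>' (\<phi> a) (D\<phi> X) W"
      using \<Omega>'_lincomb(1)[OF D\<phi>_mem[OF X] NT W] by simp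
    also have "\<dots> = 0" using \<Omega>'_skew[OF D\<phi>_mem[OF X] W] orth by simp
    finally show ?thesis by simp
  qed
  have "(THE \<tau>. \<tau> \<in> P \<and> (\<lambda>i. \<sigma> i - \<tau> i) \<in> ?Q) = \<tau>"
  proof (rule the_equality)
    have "\<sigma> (D\<mu>' W) - \<tau> (D\<mu>' W) = 0"
      if "\<alpha> \<in> P" and "represents A' \<Omega>' (\<phi> a) W (\<lambda>Y. \<alpha> (D\<mu>' Y))" for \<alpha> W
      using agree[of W] annihilator_represented_orthogonal[OF that X] that(2)
      by (simp add: represents_def)
    then show "\<tau> \<in> P \<and> (\<lambda>i. \<sigma> i - \<tau> i) \<in> ?Q"
      using \<tau> Q_iff[OF covector_diff_mem[OF \<sigma> P_cot[OF \<tau>]]] by blast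
  next
    fix \<rho> assume "\<rho> \<in> P \<and> (\<lambda>i. \<sigma> i - \<rho> i) \<in> ?Q"
    then have \<rho>: "\<rho> \<in> P" "(\<lambda>i. \<sigma> i - \<rho> i) \<in> ?Q" by auto
    obtain R where R: "represents A' \<Omega>' (\<phi> a) R (\<lambda>Y. \<rho> (D\<mu>' Y))"
      using represents_exists[OF P_cot[OF \<rho>(1)]] .
    have RT: "R \<in> T'" using R by (simp add: represents_def)
    \<comment> \<open>\<open>R\<close> and \<open>N\<close> pair equally with every vector: with the image of \<open>D\<phi>\<close>, to which both are
      orthogonal, and with its complement, where \<open>\<sigma> \<circ> D\<mu>'\<close> agrees with both \<open>\<rho> \<circ> D\<mu>'\<close> and \<open>\<tau> \<circ> D\<mu>'\<close>.\<close>
    have "represents A' \<Omega>' (\<phi> a) R (\<lambda>Y. \<tau> (D\<mu>' Y))"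
      unfolding represents_def
    proof (intro conjI RT ballI)
      fix Y' assume Y': "Y' \<in> T'"
      obtain Y W where Y: "Y \<in> T" "W \<in> T'" "Y' = lincomb 1 (D\<phi> Y) 1 W"
        and orth: "\<And>Y. Y \<in> T \<Longrightarrow> \<Omega>' (\<phi> a) W (D\<phi> Y) = 0"
        using symplectic_splitting[OF Y'] by metis
      obtain \<alpha> where \<alpha>: "\<alpha> \<in> P" "represents A' \<Omega>' (\<phi> a) W (\<lambda>Y. \<alpha> (D\<mu>' Y))"
        using orthogonal_represents_annihilator[OF Y(2) orth] by metis
      have "\<sigma> (D\<mu>' W) - \<rho> (D\<mu>' W) = 0"
        using Q_iff[OF covector_diff_mem[OF \<sigma> P_cot[OF \<rho>(1)]]] \<rho>(2) \<alpha> by blast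
      moreover have "\<sigma> (D\<mu>' W) = \<tau> (D\<mu>' W)" using agree[OF Y(2) orth[OF X]] .
      ultimately have "\<Omega>' (\<phi> a) R W = \<Omega>' (\<phi> a) N W"
        using R N Y(2) by (simp add: represents_def)
      moreover have "\<Omega>' (\<phi> a) R (D\<phi> Y) = \<Omega>' (\<phi> a) N (D\<phi> Y)"
        using annihilator_represented_orthogonal[OF \<rho>(1) R Y(1)]
          annihilator_represented_orthogonal[OF \<tau> N Y(1)] by simp
      ultimately have "\<Omega>' (\<phi> a) R Y' = \<Omega>' (\<phi> a) N Y'"
        using \<Omega>'_lincomb(2)[OF D\<phi>_mem[OF Y(1)] Y(2)] RT NT Y(3) by simp
      then show "\<Omega>' (\<phi> a) R Y' = \<tau> (D\<mu>' Y')" using N Y' by (simp add: represents_def)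
    qed
    then have eq: "\<rho> (D\<mu>' Y) = \<tau> (D\<mu>' Y)" if "Y \<in> T'" for Y
      using R that by (simp add: represents_def)
    show "\<rho> = \<tau>"
    proof
      fix Y show "\<rho> Y = \<tau> Y"
      proof (cases "Y \<in> tangent_space V' ?v")
        case True
        then show ?thesis
          using tangent_projection_surj[OF prin', of Y "\<phi> a"] eq unfolding comm_apply by metis
      next
        case False
        then show ?thesis using P_cot[OF \<tau>] P_cot[OF \<rho>(1)] by (simp add: cotangent_space_def)
      qed
    qed
  qed
  then show ?thesis by (simp add: q_tilde_def Let_def first_projector_def)
qed

text \<open>
  The bracket of the pulled-back covectors sees only the components in the image of \<open>D\<phi>\<close> of the
  representing vectors.
\<close>

lemma \<Lambda>_pullback:
  assumes \<sigma>: "\<sigma>1 \<in> cotangent_space V' (\<phi>V (\<mu> a))" "\<sigma>2 \<in> cotangent_space V' (\<phi>V (\<mu> a))"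
    and X: "X1 \<in> T" "X2 \<in> T" and N: "N1 \<in> T'" "N2 \<in> T'"
    and orth1: "\<And>Y. Y \<in> T \<Longrightarrow> \<Omega>' (\<phi> a) N1 (D\<phi> Y) = 0"
    and orth2: "\<And>Y. Y \<in> T \<Longrightarrow> \<Omega>' (\<phi> a) N2 (D\<phi> Y) = 0"
    and rep1: "represents A' \<Omega>' (\<phi> a) (lincomb 1 (D\<phi> X1) 1 N1) (\<lambda>Y. \<sigma>1 (D\<mu>' Y))"
    and rep2: "represents A' \<Omega>' (\<phi> a) (lincomb 1 (D\<phi> X2) 1 N2) (\<lambda>Y. \<sigma>2 (D\<mu>' Y))"
  shows "\<Lambda> (\<mu> a) (pullback_covec V V' \<phi>V (\<mu> a) \<sigma>1) (pullback_covec V V' \<phi>V (\<mu> a) \<sigma>2)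
    = \<Lambda>' (\<phi>V (\<mu> a)) \<sigma>1 \<sigma>2 - \<Omega>' (\<phi> a) N1 N2"
proof -
  have rep: "represents A \<Omega> a X (\<lambda>Y. pullback_covec V V' \<phi>V (\<mu> a) \<sigma> (D\<mu> Y))"
    if X: "X \<in> T" and N: "N \<in> T'" and orth: "\<And>Y. Y \<in> T \<Longrightarrow> \<Omega>' (\<phi> a) N (D\<phi> Y) = 0"
      and rep: "represents A' \<Omega>' (\<phi> a) (lincomb 1 (D\<phi> X) 1 N) (\<lambda>Y. \<sigma> (D\<mu>' Y))" for X N \<sigma>
    unfolding represents_def
  proof (intro conjI X ballI)
    fix Y assume Y: "Y \<in> T"
    have "\<Omega> a X Y = \<Omega>' (\<phi> a) (lincomb 1 (D\<phi> X) 1 N) (D\<phi> Y)"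
      using \<Omega>'_lincomb(1)[OF D\<phi>_mem[OF X] N D\<phi>_mem[OF Y]] orth[OF Y] \<Omega>_D\<phi>[OF X Y] by simp
    also have "\<dots> = \<sigma> (D\<phi>V (D\<mu> Y))"
      using rep D\<phi>_mem[OF Y] square[OF Y] by (simp add: represents_def)
    finally show "\<Omega> a X Y = pullback_covec V V' \<phi>V (\<mu> a) \<sigma> (D\<mu> Y)"
      using D\<mu>_mem[OF Y] by (simp add: pullback_covec_def)
  qed
  have "\<Lambda> (\<mu> a) (pullback_covec V V' \<phi>V (\<mu> a) \<sigma>1) (pullback_covec V V' \<phi>V (\<mu> a) \<sigma>2) = \<Omega> a X1 X2"
    using X N orth1 orth2 rep1 rep2
    by (intro induced_poisson_structure_eq[OF prin \<Omega> \<Lambda>] pullback_covec_mem[OF V V' d\<phi>V] \<sigma> rep) auto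
  moreover have "\<Lambda>' (\<phi>V (\<mu> a)) \<sigma>1 \<sigma>2
      = \<Omega>' (\<phi> a) (lincomb 1 (D\<phi> X1) 1 N1) (lincomb 1 (D\<phi> X2) 1 N2)"
    using \<Lambda>'_eq[OF \<sigma> rep1 rep2] .
  moreover have "\<dots> = \<Omega> a X1 X2 + \<Omega>' (\<phi> a) N1 N2"
  proof -
    note L1 = D\<phi>_mem[OF X(1)] and L2 = D\<phi>_mem[OF X(2)]
    have "\<Omega>' (\<phi> a) (lincomb 1 (D\<phi> X1) 1 N1) (lincomb 1 (D\<phi> X2) 1 N2)
        = \<Omega>' (\<phi> a) (D\<phi> X1) (D\<phi> X2) + \<Omega>' (\<phi> a) (D\<phi> X1) N2
          + (\<Omega>' (\<phi> a) N1 (D\<phi> X2) + \<Omega>' (\<phi> a) N1 N2)"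
      by (simp add: \<Omega>'_lincomb(1)[OF L1 N(1) lincomb_mem_tangent_space[OF A' L2 N(2)]]
          \<Omega>'_lincomb(2)[OF L2 N(2) L1] \<Omega>'_lincomb(2)[OF L2 N(2) N(1)])
    then show ?thesis
      using \<Omega>'_skew[OF L1 N(2)] orth1[OF X(2)] orth2[OF X(1)] \<Omega>_D\<phi>[OF X] by simp
  qed
  ultimately show ?thesis by simp
qed

lemma poisson_comparison_at:
  assumes \<sigma>: "\<sigma>1 \<in> cotangent_space V' (\<phi>V (\<mu> a))" "\<sigma>2 \<in> cotangent_space V' (\<phi>V (\<mu> a))"
  shows "\<Lambda> (\<mu> a) (pullback_covec V V' \<phi>V (\<mu> a) \<sigma>1) (pullback_covec V V' \<phi>V (\<mu> a) \<sigma>2)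
    = \<Lambda>' (\<phi>V (\<mu> a)) \<sigma>1 \<sigma>2
      - \<Lambda>' (\<phi>V (\<mu> a)) (q_tilde V V' \<Lambda>' \<phi>V (\<mu> a) \<sigma>1) (q_tilde V V' \<Lambda>' \<phi>V (\<mu> a) \<sigma>2)"
proof -
  have "\<exists>X N \<tau>. X \<in> T \<and> N \<in> T' \<and> (\<forall>Y\<in>T. \<Omega>' (\<phi> a) N (D\<phi> Y) = 0)
      \<and> represents A' \<Omega>' (\<phi> a) (lincomb 1 (D\<phi> X) 1 N) (\<lambda>Y. \<sigma> (D\<mu>' Y))
      \<and> \<tau> \<in> P \<and> represents A' \<Omega>' (\<phi> a) N (\<lambda>Y. \<tau> (D\<mu>' Y))"
    if \<sigma>: "\<sigma> \<in> cotangent_space V' (\<phi>V (\<mu> a))" for \<sigma>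
  proof -
    obtain X' where X': "represents A' \<Omega>' (\<phi> a) X' (\<lambda>Y. \<sigma> (D\<mu>' Y))" using represents_exists[OF \<sigma>] .
    then have "X' \<in> T'" by (simp add: represents_def)
    then obtain X N where X: "X \<in> T" "N \<in> T'" "X' = lincomb 1 (D\<phi> X) 1 N"
      and orth: "\<And>Y. Y \<in> T \<Longrightarrow> \<Omega>' (\<phi> a) N (D\<phi> Y) = 0"
      using symplectic_splitting by metis
    obtain \<tau> where "\<tau> \<in> P" "represents A' \<Omega>' (\<phi> a) N (\<lambda>Y. \<tau> (D\<mu>' Y))"
      using orthogonal_represents_annihilator[OF X(2) orth] by metis
    then show ?thesis using X X' orth by blast
  qed
  note ex = this
  obtain X1 N1 \<tau>1 where 1: "X1 \<in> T" "N1 \<in> T'" "\<And>Y. Y \<in> T \<Longrightarrow> \<Omega>' (\<phi> a) N1 (D\<phi> Y) = 0"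
      "represents A' \<Omega>' (\<phi> a) (lincomb 1 (D\<phi> X1) 1 N1) (\<lambda>Y. \<sigma>1 (D\<mu>' Y))"
      "\<tau>1 \<in> P" "represents A' \<Omega>' (\<phi> a) N1 (\<lambda>Y. \<tau>1 (D\<mu>' Y))"
    using ex[OF \<sigma>(1)] by blast
  obtain X2 N2 \<tau>2 where 2: "X2 \<in> T" "N2 \<in> T'" "\<And>Y. Y \<in> T \<Longrightarrow> \<Omega>' (\<phi> a) N2 (D\<phi> Y) = 0"
      "represents A' \<Omega>' (\<phi> a) (lincomb 1 (D\<phi> X2) 1 N2) (\<lambda>Y. \<sigma>2 (D\<mu>' Y))"
      "\<tau>2 \<in> P" "represents A' \<Omega>' (\<phi> a) N2 (\<lambda>Y. \<tau>2 (D\<mu>' Y))"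
    using ex[OF \<sigma>(2)] by blast
  have "\<Lambda>' (\<phi>V (\<mu> a)) \<tau>1 \<tau>2 = \<Omega>' (\<phi> a) N1 N2"
    using \<Lambda>'_eq[OF _ _ 1(6) 2(6)] 1(5) 2(5) by (simp add: annihilator_def)
  then show ?thesis
    using \<Lambda>_pullback[OF \<sigma> 1(1) 2(1) 1(2) 2(2) 1(3) 2(3) 1(4) 2(4)]
      q_tilde_eq[OF \<sigma>(1) 1(1,6,5,4)] q_tilde_eq[OF \<sigma>(2) 2(1,6,5,4)] by simp
qed

text \<open>If \<open>D\<phi>\<close> is onto, the symplectic complement of its image is trivial.\<close>

lemma \<Lambda>_pullback_surj:
  assumes \<sigma>: "\<sigma>1 \<in> cotangent_space V' (\<phi>V (\<mu> a))" "\<sigma>2 \<in> cotangent_space V' (\<phi>V (\<mu> a))"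
    and surj: "\<And>X'. X' \<in> T' \<Longrightarrow> \<exists>X\<in>T. D\<phi> X = X'"
  shows "\<Lambda> (\<mu> a) (pullback_covec V V' \<phi>V (\<mu> a) \<sigma>1) (pullback_covec V V' \<phi>V (\<mu> a) \<sigma>2)
    = \<Lambda>' (\<phi>V (\<mu> a)) \<sigma>1 \<sigma>2"
proof -
  let ?O = "(\<lambda>_. 0) :: ('b, 'eb) tvec"
  note Z = zero_mem_tangent_space[OF A', of "\<phi> a"]
  have Z0: "\<Omega>' (\<phi> a) ?O Y = 0" if "Y \<in> T'" for Y
    using \<Omega>'_lincomb(1)[OF Z Z that, of 0 0] by (simp add: lincomb_def)
  have ex: "\<exists>X\<in>T. represents A' \<Omega>' (\<phi> a) (lincomb 1 (D\<phi> X) 1 ?O) (\<lambda>Y. \<sigma> (D\<mu>' Y))"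
    if \<sigma>: "\<sigma> \<in> cotangent_space V' (\<phi>V (\<mu> a))" for \<sigma>
  proof -
    obtain X' where X': "represents A' \<Omega>' (\<phi> a) X' (\<lambda>Y. \<sigma> (D\<mu>' Y))" using represents_exists[OF \<sigma>] .
    then obtain X where "X \<in> T" "D\<phi> X = X'" using surj unfolding represents_def by blast
    then show ?thesis using X' by (intro bexI[of _ X]) (simp_all add: lincomb_def)
  qed
  obtain X1 where X1: "X1 \<in> T" "represents A' \<Omega>' (\<phi> a) (lincomb 1 (D\<phi> X1) 1 ?O) (\<lambda>Y. \<sigma>1 (D\<mu>' Y))"
    using ex[OF \<sigma>(1)] by blast
  obtain X2 where X2: "X2 \<in> T" "represents A' \<Omega>' (\<phi> a) (lincomb 1 (D\<phi> X2) 1 ?O) (\<lambda>Y. \<sigma>2 (D\<mu>' Y))"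
    using ex[OF \<sigma>(2)] by blast
  show ?thesis
    using \<Lambda>_pullback[OF \<sigma> X1(1) X2(1) Z Z _ _ X1(2) X2(2)] Z0 D\<phi>_mem by (simp add: Z)
qed

end

end

section \<open>Fibres and isomorphisms\<close>

text \<open>
  Local triviality alone gives \<open>\<mu> (\<psi> s a) = \<mu> a\<close> only as long as \<open>\<psi> s a\<close> stays in a trivializing
  set. But the set of all \<open>s\<close> with \<open>\<mu> (\<psi> s a) = \<mu> a\<close> is open and closed in the real line.
\<close>

lemma bundle_action_fibre:
  assumes A: "principal_R_bundle A \<psi> V \<mu>"
  shows "\<mu> (\<psi> s a) = \<mu> a"
proof -
  have \<psi>: "continuous_on UNIV (\<lambda>(s, a). \<psi> s a)" and \<mu>: "continuous_on UNIV \<mu>" and "\<psi> 0 = id"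
    using A by (simp_all add: principal_R_bundle_def smooth_map_on_def)
  have "continuous_on UNIV (\<lambda>s. (s, a))" by (intro continuous_intros)
  from continuous_on_compose2[OF \<psi> this] have "continuous_on UNIV (\<lambda>s. \<psi> s a)" by simp
  from continuous_on_compose2[OF \<mu> this] have cont: "continuous_on UNIV (\<lambda>s. \<mu> (\<psi> s a))" by simp
  let ?S = "{s. \<mu> (\<psi> s a) = \<mu> a}"
  obtain U \<Phi> where U: "open U" "\<mu> a \<in> U" and \<Phi>: "\<And>b. b \<in> \<mu> -` U \<Longrightarrow> fst (\<Phi> b) = \<mu> b"
      "\<And>b s. b \<in> \<mu> -` U \<Longrightarrow> \<Phi> (\<psi> s b) = (\<mu> b, snd (\<Phi> b) + s)"
    using bundle_trivialization[OF A] by metis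
  have "\<mu> (\<psi> s a) = \<mu> a" if "\<mu> (\<psi> s a) \<in> U" for s
    using \<Phi>(1)[of "\<psi> s a"] \<Phi>(2)[of a s] that U(2) by simp
  then have "?S = (\<lambda>s. \<mu> (\<psi> s a)) -` U" using U(2) by auto
  moreover have "open ((\<lambda>s. \<mu> (\<psi> s a)) -` U)"
    using continuous_open_preimage[OF cont open_UNIV U(1)] by simp
  ultimately have "open ?S" by simp
  moreover have "closed ?S"
  proof -
    have "?S = (\<lambda>s. \<mu> (\<psi> s a)) -` {\<mu> a}" by auto
    then show ?thesis
      using continuous_closed_preimage[OF cont closed_UNIV closed_singleton[of "\<mu> a"]] by simp
  qed
  ultimately have "?S = {} \<or> ?S = UNIV" using clopen[of ?S] by blast
  moreover have "0 \<in> ?S" using \<open>\<psi> 0 = id\<close> by simp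
  ultimately show ?thesis by blast
qed

lemma bundle_fibre_orbit:
  assumes A: "principal_R_bundle A \<psi> V \<mu>" and eq: "\<mu> a = \<mu> b"
  obtains s where "\<psi> s a = b"
proof -
  obtain U \<Phi> where U: "open U" "\<mu> a \<in> U"
    and \<Phi>: "diffeo_on A (\<mu> -` U) (prod_atlas V real_atlas) (U \<times> UNIV) \<Phi>"
      "\<And>b. b \<in> \<mu> -` U \<Longrightarrow> fst (\<Phi> b) = \<mu> b"
      "\<And>b s. b \<in> \<mu> -` U \<Longrightarrow> \<Phi> (\<psi> s b) = (\<mu> b, snd (\<Phi> b) + s)"
    using bundle_trivialization[OF A] by metis
  let ?s = "snd (\<Phi> b) - snd (\<Phi> a)"
  have mem: "\<psi> ?s a \<in> \<mu> -` U" "b \<in> \<mu> -` U" using U(2) eq bundle_action_fibre[OF A] by auto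
  have "\<Phi> (\<psi> ?s a) = \<Phi> b"
    using \<Phi>(3)[of a ?s] \<Phi>(2)[of b] U(2) eq by (simp add: prod_eq_iff)
  moreover have "inj_on \<Phi> (\<mu> -` U)" using \<Phi>(1) by (simp add: diffeo_on_def bij_betw_def)
  ultimately have "\<psi> ?s a = b" using mem by (simp add: inj_on_eq_iff)
  then show ?thesis by (rule that)
qed

lemma (in symplectic_bundle_morphism) base_map_poisson_isomorphism:
  assumes \<phi>: "diffeo A A' \<phi>" and equiv: "\<And>s. \<phi> \<circ> \<psi> s = \<psi>' s \<circ> \<phi>"
  shows "poisson_isomorphism V \<Lambda> V' \<Lambda>' \<phi>V"
proof -
  have bij: "bij \<phi>" and sm_inv: "smooth_map A' A (inv \<phi>)" using \<phi> by (auto simp: diffeo_on_def)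
  have "inj \<phi>V"
  proof (rule injI)
    fix v w assume vw: "\<phi>V v = \<phi>V w"
    obtain a b where ab: "\<mu> a = v" "\<mu> b = w" using bundle_surj[OF prin] by metis
    then have "\<mu>' (\<phi> a) = \<mu>' (\<phi> b)" using vw by (simp add: comm_apply)
    then obtain s where "\<psi>' s (\<phi> a) = \<phi> b" using bundle_fibre_orbit[OF prin'] by blast
    then have "\<phi> (\<psi> s a) = \<phi> b" using fun_cong[OF equiv[of s], of a] by simp
    then have "\<psi> s a = b" using bij by (simp add: bij_def inj_eq)
    then show "v = w" using bundle_action_fibre[OF prin, of s a] ab by simp
  qed
  moreover have "surj \<phi>V"
  proof (rule surjI)
    fix w
    show "\<phi>V (\<mu> (inv \<phi> (SOME b. \<mu>' b = w))) = w"
      using bundle_surj[OF prin', of w] bij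
      by (metis (mono_tags, lifting) bij_inv_eq_iff comm_apply someI)
  qed
  ultimately have bijV: "bij \<phi>V" by (simp add: bij_def)
  have inv_comm: "inv \<phi>V \<circ> \<mu>' = \<mu> \<circ> inv \<phi>"
  proof
    fix b
    have "\<phi>V (\<mu> (inv \<phi> b)) = \<mu>' b"
      using comm_apply[of "inv \<phi> b"] bij by (simp add: bij_def surj_f_inv_f)
    then show "(inv \<phi>V \<circ> \<mu>') b = (\<mu> \<circ> inv \<phi>) b" using bijV by (metis bij_inv_eq_iff o_apply)
  qed
  have "smooth_map V' V (inv \<phi>V)"
  proof (rule smooth_map_from_base[OF prin' V])
    show "smooth_map A' V (inv \<phi>V \<circ> \<mu>')"
      unfolding inv_comm
      by (rule smooth_map_on_compose[OF A' A V open_UNIV sm_inv bundle_smooth(3)[OF prin]]) simp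
  qed
  then have "diffeo V V' \<phi>V" using bijV smooth_base by (simp add: diffeo_on_def)
  moreover have "bivec_bracket V \<Lambda> (f \<circ> \<phi>V) (g \<circ> \<phi>V) = bivec_bracket V' \<Lambda>' f g \<circ> \<phi>V"
    if f: "smooth_fun V' f" and g: "smooth_fun V' g" for f g
  proof
    fix v
    obtain a where a: "\<mu> a = v" using bundle_surj[OF prin] by metis
    have surj: "\<exists>X\<in>tangent_space A a. tangent_map A A' \<phi> a X = X'"
      if X': "X' \<in> tangent_space A' (\<phi> a)" for X'
    proof -
      note D = smooth_map_differentiable_map_at[OF sm_inv, of "\<phi> a"]
      have i: "inv \<phi> (\<phi> a) = a" "\<phi> \<circ> inv \<phi> = id"
        using bij by (auto simp: bij_def surj_iff)
      have "tangent_map A' A (inv \<phi>) (\<phi> a) X' \<in> tangent_space A a"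
        using tangent_map_mem[OF A' A D X'] by (simp add: i)
      moreover have "tangent_map A A' \<phi> a (tangent_map A' A (inv \<phi>) (\<phi> a) X') = X'"
        using tangent_map_compose[OF A' A D, of A' \<phi> X'] d\<phi>[of a] X' tangent_map_id[OF A' X']
        by (simp add: i)
      ultimately show ?thesis by blast
    qed
    have d: "differential V (h \<circ> \<phi>V) v = pullback_covec V V' \<phi>V v (differential V' h (\<phi>V v))"
        "differential V' h (\<phi>V v) \<in> cotangent_space V' (\<phi>V v)" if "smooth_fun V' h" for h
      using differential_compose[OF V V'] differential_mem[OF V'] that
        smooth_map_differentiable_map_at[OF smooth_base] smooth_map_differentiable_map_at[OF that] by auto
    show "bivec_bracket V \<Lambda> (f \<circ> \<phi>V) (g \<circ> \<phi>V) v = (bivec_bracket V' \<Lambda>' f g \<circ> \<phi>V) v"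
      using \<Lambda>_pullback_surj[of "differential V' f (\<phi>V v)" a "differential V' g (\<phi>V v)"] surj
        d[OF f] d[OF g] by (simp add: bivec_bracket_def a)
  qed
  ultimately show ?thesis
    using smooth_base by (simp add: poisson_isomorphism_def poisson_map_def)
qed

theorem proposition3p8:
  fixes A :: "('a::{t2_space,second_countable_topology}, 'ea::euclidean_space) atlas"
    and V :: "('v::{t2_space,second_countable_topology}, 'ev::euclidean_space) atlas"
    and A' :: "('b::{t2_space,second_countable_topology}, 'eb::euclidean_space) atlas"
    and V' :: "('w::{t2_space,second_countable_topology}, 'ew::euclidean_space) atlas"
    and \<Omega> :: "('a, 'ea) form2" and \<Omega>' :: "('b, 'eb) form2"
    and \<psi> :: "real \<Rightarrow> 'a \<Rightarrow> 'a" and \<psi>' :: "real \<Rightarrow> 'b \<Rightarrow> 'b"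
    and \<mu> :: "'a \<Rightarrow> 'v" and \<mu>' :: "'b \<Rightarrow> 'w"
    and \<phi> :: "'a \<Rightarrow> 'b" and \<phi>V :: "'v \<Rightarrow> 'w"
    and \<Lambda> :: "('v, 'ev) bivec" and \<Lambda>' :: "('w, 'ew) bivec"
  assumes "symplectic_principal_R_bundle A \<Omega> \<psi> V \<mu>"
    and "symplectic_principal_R_bundle A' \<Omega>' \<psi>' V' \<mu>'"
    and "induced_poisson_structure A \<Omega> V \<mu> \<Lambda>"
    and "induced_poisson_structure A' \<Omega>' V' \<mu>' \<Lambda>'"
    and "\<mu>' \<circ> \<phi> = \<phi>V \<circ> \<mu>"
  shows "(symplectic_R_bundle_embedding A \<Omega> \<psi> A' \<Omega>' \<psi>' \<phi> \<longrightarrow>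
           (\<forall>v. \<forall>\<sigma>1\<in>cotangent_space V' (\<phi>V v). \<forall>\<sigma>2\<in>cotangent_space V' (\<phi>V v).
              \<Lambda> v (pullback_covec V V' \<phi>V v \<sigma>1) (pullback_covec V V' \<phi>V v \<sigma>2)
              = \<Lambda>' (\<phi>V v) \<sigma>1 \<sigma>2
                - \<Lambda>' (\<phi>V v) (q_tilde V V' \<Lambda>' \<phi>V v \<sigma>1) (q_tilde V V' \<Lambda>' \<phi>V v \<sigma>2)))
       \<and> (symplectic_R_bundle_isomorphism A \<Omega> \<psi> A' \<Omega>' \<psi>' \<phi> \<longrightarrow>
           poisson_isomorphism V \<Lambda> V' \<Lambda>' \<phi>V)"
proof (intro conjI impI)
  have morphism: "symplectic_bundle_morphism A V A' V' \<Omega> \<Omega>' \<psi> \<psi>' \<mu> \<mu>' \<phi> \<phi>V \<Lambda> \<Lambda>'"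
    if "smooth_map A A' \<phi>" "pulls_back_form A \<Omega> A' \<Omega>' \<phi>"
    using assms that by (simp add: symplectic_bundle_morphism_def symplectic_principal_R_bundle_def)
  {
    assume "symplectic_R_bundle_embedding A \<Omega> \<psi> A' \<Omega>' \<psi>' \<phi>"
    then interpret symplectic_bundle_morphism A V A' V' \<Omega> \<Omega>' \<psi> \<psi>' \<mu> \<mu>' \<phi> \<phi>V \<Lambda> \<Lambda>'
      by (intro morphism) (simp_all add: symplectic_R_bundle_embedding_def smooth_embedding_def)
    show "\<forall>v. \<forall>\<sigma>1\<in>cotangent_space V' (\<phi>V v). \<forall>\<sigma>2\<in>cotangent_space V' (\<phi>V v).
        \<Lambda> v (pullback_covec V V' \<phi>V v \<sigma>1) (pullback_covec V V' \<phi>V v \<sigma>2)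
        = \<Lambda>' (\<phi>V v) \<sigma>1 \<sigma>2
          - \<Lambda>' (\<phi>V v) (q_tilde V V' \<Lambda>' \<phi>V v \<sigma>1) (q_tilde V V' \<Lambda>' \<phi>V v \<sigma>2)"
    proof (intro allI ballI)
      fix v \<sigma>1 \<sigma>2
      assume \<sigma>: "\<sigma>1 \<in> cotangent_space V' (\<phi>V v)" "\<sigma>2 \<in> cotangent_space V' (\<phi>V v)"
      obtain a where "\<mu> a = v" using bundle_surj[OF prin] .
      with \<sigma> poisson_comparison_at[of \<sigma>1 a \<sigma>2]
      show "\<Lambda> v (pullback_covec V V' \<phi>V v \<sigma>1) (pullback_covec V V' \<phi>V v \<sigma>2)
          = \<Lambda>' (\<phi>V v) \<sigma>1 \<sigma>2
            - \<Lambda>' (\<phi>V v) (q_tilde V V' \<Lambda>' \<phi>V v \<sigma>1) (q_tilde V V' \<Lambda>' \<phi>V v \<sigma>2)"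
        by simp
    qed
  next
    assume iso: "symplectic_R_bundle_isomorphism A \<Omega> \<psi> A' \<Omega>' \<psi>' \<phi>"
    then interpret symplectic_bundle_morphism A V A' V' \<Omega> \<Omega>' \<psi> \<psi>' \<mu> \<mu>' \<phi> \<phi>V \<Lambda> \<Lambda>'
      by (intro morphism) (simp_all add: symplectic_R_bundle_isomorphism_def diffeo_on_def)
    show "poisson_isomorphism V \<Lambda> V' \<Lambda>' \<phi>V"
      using iso by (intro base_map_poisson_isomorphism) (simp_all add: symplectic_R_bundle_isomorphism_def)
  }
qed

end
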